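(* Let $r\ge 1$, $\alpha>0$ and $-\infty<a<b<+\infty$. The sequence $(\lambda_i)_{i\ge 1}$ given by $\lambda_1=0$ and, for $i\ge 2$, by the requirement that $\lambda_i\in(0,1)$ solves $$\chi_r(\lambda_i^{-1}-1)=\chi_r(\lambda_{i-1}-1)$$ is well defined, and for every integer $N\ge 3$: (i) if $\mu$ has density $\mathbf{1}_{[a,b]}(x)\frac{\alpha(x-a)^{\alpha-1}}{(b-a)^\alpha}$, then $\mu$ has a unique $L^r$-optimal dual quantization grid $\{x^{(N)}_1<\cdots<x^{(N)}_N\}$ at level $N$, given by $x^{(N)}_i=a+(b-a)\prod_{j=i}^{N-1}\lambda_j$ for $i=1,\ldots,N$; (ii) if $\mu$ has density $\mathbf{1}_{[a,b]}(x)\frac{\alpha(b-x)^{\alpha-1}}{(b-a)^\alpha}$, then $\mu$ has a unique $L^r$-optimal dual quantization grid $\{x^{(N)}_1<\cdots<x^{(N)}_N\}$ at level $N$, given by $x^{(N)}_{N+1-i}=b-(b-a)\prod_{j=i}^{N-1}\lambda_j$ for $i=1,\ldots,N$. Here the empty product ($i=N$) equals $1$.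
   Context: For $z\in(0,1)$, $\Psi_r(z)=(r-1)z(1-z)^r+z^{r+1}+rz^2(1-z)^{r-1}$. The function $\chi_r:[-1,+\infty)\to\mathbb{R}_+$ (depending on $\alpha$) is $$\chi_r(x)=|x|^r\int_0^1\Psi_r(1-z)(1+zx)^{\alpha-1}\,dz .$$ A dual quantization grid at level $N$ for a probability measure $\mu$ with $\mathrm{conv}(\mathrm{supp}(\mu))=[a,b]$ is a finite set $\Gamma=\{x_1<\cdots<x_M\}\subset\mathbb{R}$, $M\le N$, with $x_1\le a$ and $x_M\ge b$. It is $L^r$-optimal at level $N$ if, among all such grids, it minimizes $$\sum_{i=1}^{M-1}\int_{[x_i,x_{i+1})}\Big((\xi-x_i)^r\frac{x_{i+1}-\xi}{x_{i+1}-x_i}+(x_{i+1}-\xi)^r\frac{\xi-x_i}{x_{i+1}-x_i}\Big)\mu(d\xi).$$ *)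

theory Defs
  imports "HOL-Analysis.Analysis"
begin

definition Psi :: "real \<Rightarrow> real \<Rightarrow> real" where
  "Psi r z = (r - 1) * z * (1 - z) powr r + z powr (r + 1)
             + r * z^2 * (1 - z) powr (r - 1)"

definition chi :: "real \<Rightarrow> real \<Rightarrow> real \<Rightarrow> real" where
  "chi r \<alpha> x = \<bar>x\<bar> powr r *
     (LBINT z:{0<..<1}. Psi r (1 - z) * (1 + z * x) powr (\<alpha> - 1))"

text \<open>The sequence is indexed from 1, the value at 0 being a dummy.  The description operator
  is meaningful only once the equation is known to have exactly one solution in \<open>(0,1)\<close>.\<close>

fun grid_ratio :: "real \<Rightarrow> real \<Rightarrow> nat \<Rightarrow> real" where
  "grid_ratio r \<alpha> 0 = 0"
| "grid_ratio r \<alpha> (Suc 0) = 0"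
| "grid_ratio r \<alpha> (Suc (Suc n)) =
     (THE y. y \<in> {0<..<1} \<and> chi r \<alpha> (inverse y - 1) = chi r \<alpha> (grid_ratio r \<alpha> (Suc n) - 1))"

definition measure_support :: "real measure \<Rightarrow> real set" where
  "measure_support \<mu> = {x. \<forall>U. open U \<and> x \<in> U \<longrightarrow> emeasure \<mu> U > 0}"

definition dual_quant_grid :: "real measure \<Rightarrow> nat \<Rightarrow> real set \<Rightarrow> bool" where
  "dual_quant_grid \<mu> N \<Gamma> \<longleftrightarrow> finite \<Gamma> \<and> \<Gamma> \<noteq> {} \<and> card \<Gamma> \<le> N \<and>
     (\<exists>a b. a \<le> b \<and> convex hull (measure_support \<mu>) = {a..b} \<and> Min \<Gamma> \<le> a \<and> b \<le> Max \<Gamma>)"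

definition dual_quant_cost :: "real measure \<Rightarrow> real \<Rightarrow> real set \<Rightarrow> real" where
  "dual_quant_cost \<mu> r \<Gamma> = (let x = (\<lambda>i. sorted_list_of_set \<Gamma> ! i) in
     \<Sum>i<card \<Gamma> - 1. set_lebesgue_integral \<mu> {x i..<x (i + 1)}
       (\<lambda>\<xi>. (\<xi> - x i) powr r * ((x (i + 1) - \<xi>) / (x (i + 1) - x i))
           + (x (i + 1) - \<xi>) powr r * ((\<xi> - x i) / (x (i + 1) - x i))))"

definition optimal_dual_quant_grid :: "real measure \<Rightarrow> real \<Rightarrow> nat \<Rightarrow> real set \<Rightarrow> bool" where
  "optimal_dual_quant_grid \<mu> r N \<Gamma> \<longleftrightarrow> dual_quant_grid \<mu> N \<Gamma> \<and>
     (\<forall>\<Gamma>'. dual_quant_grid \<mu> N \<Gamma>' \<longrightarrow> dual_quant_cost \<mu> r \<Gamma> \<le> dual_quant_cost \<mu> r \<Gamma>')"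

end

theory Submission
  imports Defs
begin

text \<open>
  For the power density on \<open>[0, 1]\<close> the cost of a cell \<open>[t u, t v]\<close> is \<open>t powr (r + \<alpha>)\<close> times that of
  \<open>[u, v]\<close>, so the problem is a dynamic program: with \<open>V n\<close> the optimal cost with \<open>n\<close> cells,
  \<open>V (n + 1)\<close> minimises \<open>C l + l powr (r + \<alpha>) * V n\<close> over the last inner point \<open>l\<close>, where \<open>C l\<close>
  is the cost of the cell \<open>[l, 1]\<close>. By Tonelli \<open>C l\<close> is the integral over \<open>[l, 1]\<close> of
  \<open>s powr (r + \<alpha> - 1) * chi (1/s - 1)\<close>, and an integration by parts gives Euler's relation
  \<open>(r + \<alpha>) * C l = chi (l - 1) - l powr (r + \<alpha>) * chi (1/l - 1)\<close>. The latter yields inductively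
  \<open>(r + \<alpha>) * V n = chi (\<lambda>\<^sub>n - 1)\<close>; since \<open>chi\<close> increases strictly on the positive axis, the former
  shows that the minimiser is unique and solves \<open>chi (1/l - 1) = chi (\<lambda>\<^sub>n - 1)\<close>.
\<close>

text \<open>The function chi is a derivative of the cell cost in disguise. Moving the left end of
  \<open>[l, 1]\<close> to the right lowers the local costs at the total rate
  \<open>l powr (r + \<alpha> - 1) * chi r \<alpha> (1/l - 1)\<close>; moving the right end outwards
  raises them at the rate \<open>chi r \<alpha> (l - 1)\<close>. The equation for the ratios is thus
  the balance of two forces at an inner grid point, and Euler's relation reflects the homogeneity of
  the cost. Two obstacles shape the proof. For \<alpha> < 1 the density is unbounded at 0 and the
  kernel of chi is singular at argument -1; hence the cell cost is never differentiated, and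
  differences of costs are instead squeezed between values of chi at the two ends. Moreover a
  competing grid may have fewer points or reach beyond the interval; it is excluded by strict
  inequalities, for cells pulled back into the interval and for optimal values with different
  numbers of cells.\<close>

section \<open>Integration on the real line\<close>

lemma has_bochner_integral_Ioo:
  fixes f :: "real \<Rightarrow> real"
  assumes I: "(f has_integral I) {a..b}" and nn: "\<And>x. a < x \<Longrightarrow> x < b \<Longrightarrow> 0 \<le> f x"
    and [measurable]: "(\<lambda>x. indicator {a<..<b} x * f x) \<in> borel_measurable borel"
  shows "has_bochner_integral lborel (\<lambda>x. indicator {a<..<b} x * f x) I"
proof -
  have "(f has_integral I) {a<..<b}" using I by (simp add: has_integral_Icc_iff_Ioo)
  then have "((\<lambda>x. if x \<in> {a<..<b} then f x else 0) has_integral I) UNIV"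
    by (simp only: has_integral_restrict_UNIV)
  also have "(\<lambda>x. if x \<in> {a<..<b} then f x else 0) = (\<lambda>x. indicator {a<..<b} x * f x)"
    by (auto simp: indicator_def)
  finally have *: "((\<lambda>x. indicator {a<..<b} x * f x) has_integral I) UNIV" .
  have nn': "0 \<le> indicator {a<..<b} x * f x" for x using nn by (auto simp: indicator_def)
  show ?thesis
  proof (rule has_bochner_integral_nn_integral)
    show "0 \<le> I" using has_integral_nonneg[OF *] nn' by blast
    show "(\<integral>\<^sup>+x. ennreal (indicator {a<..<b} x * f x) \<partial>lborel) = ennreal I"
      by (rule nn_integral_has_integral_lborel[OF _ nn' *]) simp
  qed (use nn' in auto)
qed

lemma integral_strict_mono:
  fixes f g :: "real \<Rightarrow> real"
  assumes f: "integrable lborel f" and g: "integrable lborel g" and le: "\<And>x. f x \<le> g x"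
    and less: "\<And>x. a < x \<Longrightarrow> x < b \<Longrightarrow> f x < g x" and "a < b"
  shows "integral\<^sup>L lborel f < integral\<^sup>L lborel g"
proof -
  have "integral\<^sup>L lborel (\<lambda>x. g x - f x) \<noteq> 0"
  proof
    assume "integral\<^sup>L lborel (\<lambda>x. g x - f x) = 0"
    then have "AE x in lborel. g x - f x = 0"
      using integral_nonneg_eq_0_iff_AE[of lborel "\<lambda>x. g x - f x"] f g le by auto
    then have "AE x in lborel. x \<notin> {a<..<b}"
      by (elim eventually_mono) (use less in force)
    then have "emeasure lborel {x \<in> space lborel. \<not> x \<notin> {a<..<b}} = 0"
      by (subst (asm) AE_iff_measurable[OF _ refl]) auto
    moreover have "{x \<in> space lborel. \<not> x \<notin> {a<..<b}} = {a<..<b}" by auto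
    ultimately show False using emeasure_lborel_Ioo[of a b] \<open>a < b\<close> by simp
  qed
  moreover have "0 \<le> integral\<^sup>L lborel (\<lambda>x. g x - f x)" using le by simp
  ultimately show ?thesis using f g by simp
qed

section \<open>The function chi and the ratios\<close>

locale dual_quant =
  fixes r \<alpha> :: real
  assumes r_ge_1: "r \<ge> 1" and alpha_pos: "\<alpha> > 0"
begin

lemma Psi_reflect:
  "Psi r (1 - z) = (r - 1) * (1 - z) * z powr r + (1 - z) powr (r + 1) + r * (1 - z)^2 * z powr (r - 1)"
  by (simp add: Psi_def)

lemma Psi_pos:
  assumes "0 < z" "z < 1" shows "0 < Psi r (1 - z)"
proof -
  have "0 \<le> (r - 1) * (1 - z) * z powr r" "0 < (1 - z) powr (r + 1)" "0 \<le> r * (1 - z)^2 * z powr (r - 1)"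
    using assms r_ge_1 by auto
  then show ?thesis unfolding Psi_reflect by linarith
qed

text \<open>The factor \<open>1 - z\<close> is what makes chi finite at -1: there
  \<open>1 + z * x\<close> becomes \<open>1 - z\<close>, whose power \<open>\<alpha> - 1\<close>
  alone need not be integrable at z = 1.\<close>

lemma Psi_le:
  assumes "0 < z" "z < 1" shows "Psi r (1 - z) \<le> 2 * r * (1 - z)"
proof -
  have le1: "z powr r \<le> 1" "z powr (r - 1) \<le> 1" "(1 - z) powr r \<le> 1"
    using assms r_ge_1 by (auto intro: powr_le1)
  have "(r - 1) * (1 - z) * z powr r \<le> (r - 1) * (1 - z) * 1"
    using assms r_ge_1 le1 by (intro mult_left_mono) auto
  moreover have "(1 - z) powr (r + 1) \<le> (1 - z) * 1"
    using assms le1 by (simp add: powr_add mult_left_le_one_le)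
  moreover have "(1 - z)^2 * z powr (r - 1) \<le> (1 - z) * 1"
    using assms le1 by (intro mult_mono) (auto simp: power2_eq_square mult_left_le)
  then have "r * ((1 - z)^2 * z powr (r - 1)) \<le> r * ((1 - z) * 1)"
    using r_ge_1 by (intro mult_left_mono) auto
  ultimately show ?thesis unfolding Psi_reflect by (simp add: algebra_simps)
qed

definition chi_kernel :: "real \<Rightarrow> real \<Rightarrow> real" where
  "chi_kernel x z = indicator {0<..<1} z * (Psi r (1 - z) * (1 + z * x) powr (\<alpha> - 1))"

lemma chi_eq: "chi r \<alpha> x = \<bar>x\<bar> powr r * integral\<^sup>L lborel (chi_kernel x)"
  unfolding chi_def set_lebesgue_integral_def chi_kernel_def[abs_def] by simp

lemma chi_kernel_measurable [measurable]: "chi_kernel x \<in> borel_measurable borel"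
  unfolding chi_kernel_def[abs_def] Psi_def by measurable

lemma chi_kernel_nonneg: "0 \<le> chi_kernel x z"
  using Psi_pos[of z] by (auto simp: chi_kernel_def indicator_def less_imp_le)

lemma chi_kernel_pos:
  assumes "x \<ge> -1" "0 < z" "z < 1" shows "0 < chi_kernel x z"
proof -
  have "z * (-1) \<le> z * x" using assms by (intro mult_left_mono) auto
  then have "0 < 1 + z * x" using assms by linarith
  then show ?thesis using Psi_pos[of z] assms by (auto simp: chi_kernel_def indicator_def)
qed

lemma chi_kernel_integrable:
  assumes "x \<ge> -1" shows "integrable lborel (chi_kernel x)"
proof -
  \<comment> \<open>The inner sum adds the bounds of the two cases:
    \<open>(1 + \<bar>x\<bar>) powr (\<alpha> - 1)\<close> for \<alpha> \<ge> 1, and 1 for \<alpha>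
    < 1, where \<open>(1 - z) powr \<alpha>\<close> remains after cancellation.\<close>
  define B where "B = 2 * r * (1 + (1 + \<bar>x\<bar>) powr (\<alpha> - 1))"
  have bd: "\<bar>chi_kernel x z\<bar> \<le> B * indicator {0<..<1} z" for z
  proof (cases "0 < z \<and> z < 1")
    case True
    have "z * (-1) \<le> z * x" using assms True by (intro mult_left_mono) auto
    then have lo: "1 - z \<le> 1 + z * x" by simp
    have "z * x \<le> 1 * \<bar>x\<bar>"
      using True by (metis abs_ge_self abs_ge_zero abs_mult abs_of_pos less_imp_le mult_right_mono order_trans)
    then have hi: "1 + z * x \<le> 1 + \<bar>x\<bar>" by simp
    have *: "(1 - z) * (1 + z * x) powr (\<alpha> - 1) \<le> 1 + (1 + \<bar>x\<bar>) powr (\<alpha> - 1)"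
    proof (cases "\<alpha> \<ge> 1")
      case a: True
      have "(1 + z * x) powr (\<alpha> - 1) \<le> (1 + \<bar>x\<bar>) powr (\<alpha> - 1)"
        using lo hi True a by (intro powr_mono2) auto
      then have "(1 - z) * (1 + z * x) powr (\<alpha> - 1) \<le> 1 * (1 + \<bar>x\<bar>) powr (\<alpha> - 1)"
        using True by (intro mult_mono) auto
      then show ?thesis by simp
    next
      case a: False
      have "(1 + z * x) powr (\<alpha> - 1) \<le> (1 - z) powr (\<alpha> - 1)"
        using lo True a by (intro powr_mono2') auto
      then have "(1 - z) * (1 + z * x) powr (\<alpha> - 1) \<le> (1 - z) * (1 - z) powr (\<alpha> - 1)"
        using True by (intro mult_left_mono) auto
      also have "\<dots> = (1 - z) powr \<alpha>" using True by (simp add: powr_diff)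
      also have "\<dots> \<le> 1" using True alpha_pos by (intro powr_le1) auto
      finally show ?thesis by (simp add: add_increasing2)
    qed
    have "Psi r (1 - z) * (1 + z * x) powr (\<alpha> - 1) \<le> (2 * r * (1 - z)) * (1 + z * x) powr (\<alpha> - 1)"
      using Psi_le True by (intro mult_right_mono) auto
    also have "\<dots> = 2 * r * ((1 - z) * (1 + z * x) powr (\<alpha> - 1))" by simp
    also have "\<dots> \<le> B" unfolding B_def using * r_ge_1 by (intro mult_left_mono) auto
    finally show ?thesis using True chi_kernel_nonneg[of x z] by (simp add: chi_kernel_def)
  qed (auto simp: chi_kernel_def)
  show ?thesis
  proof (rule Bochner_Integration.integrable_bound)
    show "integrable lborel (\<lambda>z::real. B * indicator {0<..<1} z)"
      by (intro integrable_mult_right integrable_real_indicator) auto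
    show "AE z in lborel. norm (chi_kernel x z) \<le> norm (B * indicator {0<..<1} z)"
      using bd by (intro AE_I2) (metis abs_ge_self order_trans real_norm_def)
  qed simp
qed

lemma chi_kernel_integral_pos:
  assumes "x \<ge> -1" shows "0 < integral\<^sup>L lborel (chi_kernel x)"
  using integral_strict_mono[of "\<lambda>_. 0" "chi_kernel x" 0 1] chi_kernel_integrable[OF assms]
    chi_kernel_nonneg[of x] chi_kernel_pos[OF assms] by simp

lemma chi_pos: "x \<ge> -1 \<Longrightarrow> x \<noteq> 0 \<Longrightarrow> 0 < chi r \<alpha> x"
  unfolding chi_eq using chi_kernel_integral_pos by simp

section \<open>Monotonicity, continuity and range of chi on the positive axis\<close>

text \<open>With \<open>t = y/x\<close>, the quotient of \<open>1 + z*y\<close> by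
  \<open>1 + z*x\<close> lies between 1 and t, so its power \<open>\<alpha> - 1\<close> lies between
  1 and \<open>t powr (\<alpha> - 1)\<close>, in an order that depends on the sign of
  \<open>\<alpha> - 1\<close>. The bounds are uniform in z and survive integration.\<close>

lemma kernel_ratio:
  fixes x y z :: real
  assumes "0 < x" "x \<le> y" "0 < z"
  shows "(y/x) powr (min r (r + \<alpha> - 1)) * (x powr r * (1 + z*x) powr (\<alpha> - 1)) \<le> y powr r * (1 + z*y) powr (\<alpha> - 1)"
    and "y powr r * (1 + z*y) powr (\<alpha> - 1) \<le> (y/x) powr (max r (r + \<alpha> - 1)) * (x powr r * (1 + z*x) powr (\<alpha> - 1))"
proof -
  define t where "t = y / x"
  have t: "t \<ge> 1" "t > 0" and y: "y = t * x" using assms by (auto simp: t_def)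
  define s where "s = (1 + z*y) / (1 + z*x)"
  have px: "0 < 1 + z*x" "0 < 1 + z*y" using assms by (auto intro!: add_pos_pos)
  have s1: "1 \<le> s" "s \<le> t" unfolding s_def using px assms t
    by (auto simp: y divide_simps algebra_simps)
  have e: "y powr r * (1 + z*y) powr (\<alpha> - 1) = t powr r * s powr (\<alpha> - 1) * (x powr r * (1 + z*x) powr (\<alpha> - 1))"
    using assms px t unfolding s_def by (simp add: y powr_mult powr_divide)
  have "t powr (min r (r + \<alpha> - 1)) \<le> t powr r * s powr (\<alpha> - 1) \<and>
        t powr r * s powr (\<alpha> - 1) \<le> t powr (max r (r + \<alpha> - 1))"
  proof (cases "\<alpha> \<ge> 1")
    case True
    have "1 \<le> s powr (\<alpha> - 1)" "s powr (\<alpha> - 1) \<le> t powr (\<alpha> - 1)"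
      using s1 True by (auto intro: powr_mono2 ge_one_powr_ge_zero)
    then have "t powr r * 1 \<le> t powr r * s powr (\<alpha> - 1)"
      "t powr r * s powr (\<alpha> - 1) \<le> t powr r * t powr (\<alpha> - 1)"
      using t by (auto intro!: mult_left_mono)
    then show ?thesis using True t by (simp add: powr_add[symmetric] min_def max_def add_diff_eq)
  next
    case False
    have "s powr (\<alpha> - 1) \<le> 1" "t powr (\<alpha> - 1) \<le> s powr (\<alpha> - 1)"
      using s1 False powr_mono2'[of "\<alpha> - 1" 1 s] by (auto intro: powr_mono2')
    then have "t powr r * s powr (\<alpha> - 1) \<le> t powr r * 1"
      "t powr r * t powr (\<alpha> - 1) \<le> t powr r * s powr (\<alpha> - 1)"
      using t by (auto intro!: mult_left_mono)
    then show ?thesis using False t by (simp add: powr_add[symmetric] min_def max_def add_diff_eq)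
  qed
  then show "(y/x) powr (min r (r + \<alpha> - 1)) * (x powr r * (1 + z*x) powr (\<alpha> - 1)) \<le> y powr r * (1 + z*y) powr (\<alpha> - 1)"
    "y powr r * (1 + z*y) powr (\<alpha> - 1) \<le> (y/x) powr (max r (r + \<alpha> - 1)) * (x powr r * (1 + z*x) powr (\<alpha> - 1))"
    unfolding e t_def[symmetric] by (auto intro!: mult_right_mono)
qed

text \<open>These power bounds are all that is used about the growth of chi: strict monotonicity,
  continuity and surjectivity follow from them. Both exponents are positive because r \<ge> 1 and
  \<alpha> > 0.\<close>

lemma chi_ratio:
  assumes "0 < x" "x \<le> y"
  shows "(y/x) powr (min r (r + \<alpha> - 1)) * chi r \<alpha> x \<le> chi r \<alpha> y"
    and "chi r \<alpha> y \<le> (y/x) powr (max r (r + \<alpha> - 1)) * chi r \<alpha> x"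
proof -
  have i: "integrable lborel (chi_kernel x)" "integrable lborel (chi_kernel y)"
    using assms by (auto intro!: chi_kernel_integrable)
  have c: "chi r \<alpha> x = (\<integral>z. x powr r * chi_kernel x z \<partial>lborel)"
          "chi r \<alpha> y = (\<integral>z. y powr r * chi_kernel y z \<partial>lborel)"
    using assms by (auto simp: chi_eq)
  have 1: "(y/x) powr (min r (r + \<alpha> - 1)) * (x powr r * chi_kernel x z) \<le> y powr r * chi_kernel y z"
   and 2: "y powr r * chi_kernel y z \<le> (y/x) powr (max r (r + \<alpha> - 1)) * (x powr r * chi_kernel x z)" for z
  proof -
    show "(y/x) powr (min r (r + \<alpha> - 1)) * (x powr r * chi_kernel x z) \<le> y powr r * chi_kernel y z"
    proof (cases "0 < z \<and> z < 1")
      case True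
      then show ?thesis using mult_left_mono[OF kernel_ratio(1)[OF assms, of z], of "Psi r (1-z)"] Psi_pos[of z]
        by (simp add: chi_kernel_def mult_ac)
    qed (auto simp: chi_kernel_def)
    show "y powr r * chi_kernel y z \<le> (y/x) powr (max r (r + \<alpha> - 1)) * (x powr r * chi_kernel x z)"
    proof (cases "0 < z \<and> z < 1")
      case True
      then show ?thesis using mult_left_mono[OF kernel_ratio(2)[OF assms, of z], of "Psi r (1-z)"] Psi_pos[of z]
        by (simp add: chi_kernel_def mult_ac)
    qed (auto simp: chi_kernel_def)
  qed
  have "(\<integral>z. (y/x) powr (min r (r + \<alpha> - 1)) * (x powr r * chi_kernel x z) \<partial>lborel) \<le> chi r \<alpha> y"
    unfolding c by (intro integral_mono integrable_mult_right i 1)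
  then show "(y/x) powr (min r (r + \<alpha> - 1)) * chi r \<alpha> x \<le> chi r \<alpha> y" by (simp add: c)
  have "chi r \<alpha> y \<le> (\<integral>z. (y/x) powr (max r (r + \<alpha> - 1)) * (x powr r * chi_kernel x z) \<partial>lborel)"
    unfolding c by (intro integral_mono integrable_mult_right i 2)
  then show "chi r \<alpha> y \<le> (y/x) powr (max r (r + \<alpha> - 1)) * chi r \<alpha> x" by (simp add: c)
qed

lemma exponents_pos: "0 < min r (r + \<alpha> - 1)" "0 < max r (r + \<alpha> - 1)"
  using r_ge_1 alpha_pos by (auto simp: less_max_iff_disj)

lemma chi_strict_mono:
  assumes "0 < x" "x < y" shows "chi r \<alpha> x < chi r \<alpha> y"
proof -
  have "1 < (y/x) powr (min r (r + \<alpha> - 1))"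
    using assms exponents_pos by (intro gr_one_powr) auto
  then have "1 * chi r \<alpha> x < (y/x) powr (min r (r + \<alpha> - 1)) * chi r \<alpha> x"
    using chi_pos[of x] assms by (intro mult_strict_right_mono) auto
  also have "\<dots> \<le> chi r \<alpha> y" using chi_ratio(1)[of x y] assms by simp
  finally show ?thesis by simp
qed

text \<open>For y < x the roles of x and y in \<open>chi_ratio\<close> are exchanged, and with them
  those of the two exponents. The minimum and the maximum of the two powers cover both sides at
  once, and both tend to 1 as y tends to x.\<close>

lemma chi_continuous: "continuous_on {0<..} (chi r \<alpha>)"
proof -
  have "(chi r \<alpha> \<longlongrightarrow> chi r \<alpha> x) (at x)" if x: "0 < x" for x
  proof -
    define k K where "k = min r (r + \<alpha> - 1)" and "K = max r (r + \<alpha> - 1)"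
    have ev: "\<forall>\<^sub>F y in at x. 0 < y"
      using x by (intro eventually_at_in_open'[of "{0<..}", simplified]) auto
    have lo: "min ((y/x) powr k) ((y/x) powr K) * chi r \<alpha> x \<le> chi r \<alpha> y"
     and hi: "chi r \<alpha> y \<le> max ((y/x) powr k) ((y/x) powr K) * chi r \<alpha> x" if y: "0 < y" for y
    proof -
      have p: "0 < chi r \<alpha> x" using chi_pos[of x] x by simp
      show "min ((y/x) powr k) ((y/x) powr K) * chi r \<alpha> x \<le> chi r \<alpha> y"
      proof (cases "x \<le> y")
        case True
        have "min ((y/x) powr k) ((y/x) powr K) * chi r \<alpha> x \<le> (y/x) powr k * chi r \<alpha> x"
          using p by (intro mult_right_mono) auto
        then show ?thesis using chi_ratio(1)[OF x True] by (simp add: k_def)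
      next
        case False
        then have "chi r \<alpha> x \<le> (x/y) powr K * chi r \<alpha> y"
          using chi_ratio(2)[of y x] y by (simp add: K_def)
        then have "(y/x) powr K * chi r \<alpha> x \<le> (y/x) powr K * ((x/y) powr K * chi r \<alpha> y)"
          by (intro mult_left_mono) auto
        also have "\<dots> = ((y/x) * (x/y)) powr K * chi r \<alpha> y"
          using x y by (subst powr_mult) auto
        also have "\<dots> = chi r \<alpha> y" using x y by simp
        finally have "(y/x) powr K * chi r \<alpha> x \<le> chi r \<alpha> y" .
        moreover have "min ((y/x) powr k) ((y/x) powr K) * chi r \<alpha> x \<le> (y/x) powr K * chi r \<alpha> x"
          using p by (intro mult_right_mono) auto
        ultimately show ?thesis by linarith
      qed
      show "chi r \<alpha> y \<le> max ((y/x) powr k) ((y/x) powr K) * chi r \<alpha> x"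
      proof (cases "x \<le> y")
        case True
        have "(y/x) powr K * chi r \<alpha> x \<le> max ((y/x) powr k) ((y/x) powr K) * chi r \<alpha> x"
          using p by (intro mult_right_mono) auto
        then show ?thesis using chi_ratio(2)[OF x True] by (simp add: K_def)
      next
        case False
        then have "(x/y) powr k * chi r \<alpha> y \<le> chi r \<alpha> x"
          using chi_ratio(1)[of y x] y by (simp add: k_def)
        then have "(y/x) powr k * ((x/y) powr k * chi r \<alpha> y) \<le> (y/x) powr k * chi r \<alpha> x"
          by (intro mult_left_mono) auto
        moreover have "(y/x) powr k * ((x/y) powr k * chi r \<alpha> y) = ((y/x) * (x/y)) powr k * chi r \<alpha> y"
          using x y by (subst powr_mult) auto
        moreover have "\<dots> = chi r \<alpha> y" using x y by simp
        moreover have "(y/x) powr k * chi r \<alpha> x \<le> max ((y/x) powr k) ((y/x) powr K) * chi r \<alpha> x"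
          using p by (intro mult_right_mono) auto
        ultimately show ?thesis by linarith
      qed
    qed
    have a: "((\<lambda>y. (y/x) powr e) \<longlongrightarrow> 1) (at x)" for e
      using x by (auto intro!: tendsto_eq_intros)
    have lim: "((\<lambda>y. min ((y/x) powr k) ((y/x) powr K) * chi r \<alpha> x) \<longlongrightarrow> min 1 1 * chi r \<alpha> x) (at x)"
         "((\<lambda>y. max ((y/x) powr k) ((y/x) powr K) * chi r \<alpha> x) \<longlongrightarrow> max 1 1 * chi r \<alpha> x) (at x)"
      by (intro tendsto_mult tendsto_min tendsto_max a tendsto_const)+
    show ?thesis
    proof (rule tendsto_sandwich)
      show "\<forall>\<^sub>F y in at x. min ((y/x) powr k) ((y/x) powr K) * chi r \<alpha> x \<le> chi r \<alpha> y"
        using ev by (elim eventually_mono) (rule lo)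
      show "\<forall>\<^sub>F y in at x. chi r \<alpha> y \<le> max ((y/x) powr k) ((y/x) powr K) * chi r \<alpha> x"
        using ev by (elim eventually_mono) (rule hi)
    qed (use lim in simp_all)
  qed
  then show ?thesis by (auto simp: continuous_on_eq_continuous_at isCont_def)
qed

lemma chi_surj:
  assumes "0 < c" shows "\<exists>x>0. chi r \<alpha> x = c"
proof -
  define k where "k = min r (r + \<alpha> - 1)"
  have k: "0 < k" using exponents_pos by (simp add: k_def)
  define d where "d = chi r \<alpha> 1"
  have d: "0 < d" using chi_pos[of 1] by (simp add: d_def)
  \<comment> \<open>The power solves \<open>d * w powr k = c\<close>, where \<open>d\<close> is the
    value of chi at 1. Cutting off at 1, from above for x and from below for y, puts each point on
    the side of 1 on which the lower bound of \<open>chi_ratio\<close> compares it with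
    \<open>d\<close>.\<close>
  define x where "x = min 1 ((c / d) powr (1/k))"
  define y where "y = max 1 ((c / d) powr (1/k))"
  have x: "0 < x" "x \<le> 1" and y: "1 \<le> y" using assms d by (auto simp: x_def y_def)
  have inv: "((c/d) powr (1/k)) powr k = c / d" using assms d k by (simp add: powr_powr)
  have "(1/x) powr k * chi r \<alpha> x \<le> d" using chi_ratio(1)[OF x] by (simp add: k_def d_def)
  then have "x powr k * ((1/x) powr k * chi r \<alpha> x) \<le> x powr k * d" by (intro mult_left_mono) auto
  then have "chi r \<alpha> x \<le> x powr k * d" using x by (simp add: powr_divide)
  also have "x powr k \<le> c / d" using powr_mono2[of k x "(c/d) powr (1/k)"] x k unfolding inv by (simp add: x_def)
  then have "x powr k * d \<le> c" using d by (simp add: field_simps)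
  finally have lo: "chi r \<alpha> x \<le> c" .
  have "c / d \<le> y powr k" using powr_mono2[of k "(c/d) powr (1/k)" y] k unfolding inv by (simp add: y_def)
  then have "c \<le> y powr k * d" using d by (simp add: field_simps)
  also have "\<dots> \<le> chi r \<alpha> y" using chi_ratio(1)[of 1 y] y by (simp add: k_def d_def)
  finally have hi: "c \<le> chi r \<alpha> y" .
  have "continuous_on {x..y} (chi r \<alpha>)"
    using x by (intro continuous_on_subset[OF chi_continuous]) auto
  then show ?thesis using IVT'[of "chi r \<alpha>" x c y] lo hi x y by (smt (verit))
qed

lemma chi_inj: "0 < x \<Longrightarrow> 0 < y \<Longrightarrow> chi r \<alpha> x = chi r \<alpha> y \<Longrightarrow> x = y"
  by (metis chi_strict_mono less_irrefl linorder_neqE_linordered_idom)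

text \<open>Stated for an arbitrary positive level c, since in the recursion the right-hand side is
  a value of chi at a negative argument, where positivity suffices. The map from y to
  \<open>inverse y - 1\<close> carries (0, 1) bijectively to the positive axis.\<close>

lemma ratio_ex1:
  assumes "0 < c" shows "\<exists>!y. y \<in> {0<..<1} \<and> chi r \<alpha> (inverse y - 1) = c"
proof -
  obtain x where x: "0 < x" "chi r \<alpha> x = c" using chi_surj[OF assms] by blast
  show ?thesis
  proof (rule ex1I[of _ "inverse (1 + x)"])
    show "inverse (1 + x) \<in> {0<..<1} \<and> chi r \<alpha> (inverse (inverse (1 + x)) - 1) = c"
      using x by (simp add: inverse_less_1_iff)
  next
    fix y assume y: "y \<in> {0<..<1} \<and> chi r \<alpha> (inverse y - 1) = c"
    then have "1 < inverse y" by (intro one_less_inverse) (simp_all only: greaterThanLessThan_iff)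
    then have "0 < inverse y - 1" by linarith
    moreover have "chi r \<alpha> (inverse y - 1) = chi r \<alpha> x" using x y by simp
    ultimately have "inverse y - 1 = x" using x by (metis chi_inj)
    then have "inverse y = 1 + x" by linarith
    then show "y = inverse (1 + x)" by (metis inverse_inverse_eq)
  qed
qed

section \<open>The recursion for the ratios\<close>

abbreviation G where "G \<equiv> grid_ratio r \<alpha>"

lemma G_Suc:
  assumes "n \<ge> 1" "0 \<le> G n" "G n < 1"
  shows "0 < G (Suc n)" "G (Suc n) < 1" "chi r \<alpha> (inverse (G (Suc n)) - 1) = chi r \<alpha> (G n - 1)"
proof -
  have "0 < chi r \<alpha> (G n - 1)" using assms by (intro chi_pos) auto
  note * = theI'[OF ratio_ex1[OF this]]
  obtain m where m: "n = Suc m" using assms(1) by (cases n) auto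
  have e: "G (Suc n) = (THE y. y \<in> {0<..<1} \<and> chi r \<alpha> (inverse y - 1) = chi r \<alpha> (G n - 1))"
    unfolding m grid_ratio.simps(3) ..
  show "0 < G (Suc n)" "G (Suc n) < 1" "chi r \<alpha> (inverse (G (Suc n)) - 1) = chi r \<alpha> (G n - 1)"
    using * unfolding e[symmetric] by (auto simp only: greaterThanLessThan_iff)
qed

lemma G_bounds: "n \<ge> 1 \<Longrightarrow> 0 \<le> G n \<and> G n < 1"
proof (induction n rule: dec_induct)
  case (step n) then show ?case using G_Suc[of n] by auto
qed simp

lemma G_pos: "n \<ge> 2 \<Longrightarrow> 0 < G n"
  using G_Suc[of "n - 1"] G_bounds[of "n-1"] by (cases n) auto

lemma G_eq: "n \<ge> 1 \<Longrightarrow> chi r \<alpha> (inverse (G (Suc n)) - 1) = chi r \<alpha> (G n - 1)"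
  using G_Suc[of n] G_bounds[of n] by auto

lemma ratio_well_defined:
  "\<forall>i\<ge>2. \<exists>!y. y \<in> {0<..<1} \<and> chi r \<alpha> (inverse y - 1) = chi r \<alpha> (G (i - 1) - 1)"
proof (intro allI impI)
  fix i :: nat assume "2 \<le> i"
  then have "0 < chi r \<alpha> (G (i - 1) - 1)" using G_bounds[of "i-1"] by (intro chi_pos) (auto simp: le_diff_conv2)
  then show "\<exists>!y. y \<in> {0<..<1} \<and> chi r \<alpha> (inverse y - 1) = chi r \<alpha> (G (i - 1) - 1)"
    by (rule ratio_ex1)
qed

end

section \<open>The cost of a single cell\<close>

text \<open>The local cost at distances \<open>p\<close> and \<open>q\<close> from the two neighbouring grid points, and its partial
  derivative in the first argument.\<close>

definition interp :: "real \<Rightarrow> real \<Rightarrow> real \<Rightarrow> real" where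
  "interp r p q = (p powr r * q + q powr r * p) / (p + q)"

definition dinterp :: "real \<Rightarrow> real \<Rightarrow> real \<Rightarrow> real" where
  "dinterp r p q = ((r - 1) * p powr r * q + q powr (r + 1) + r * q^2 * p powr (r - 1)) / (p + q)^2"

lemma interp_measurable [measurable (raw)]:
  assumes [measurable]: "f \<in> borel_measurable M" "g \<in> borel_measurable M"
  shows "(\<lambda>x. interp r (f x) (g x)) \<in> borel_measurable M"
  unfolding interp_def by measurable

lemma dinterp_measurable [measurable (raw)]:
  assumes [measurable]: "f \<in> borel_measurable M" "g \<in> borel_measurable M"
  shows "(\<lambda>x. dinterp r (f x) (g x)) \<in> borel_measurable M"
  unfolding dinterp_def by measurable

lemma interp_commute: "interp r p q = interp r q p"
  by (simp add: interp_def add.commute)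

lemma powr_pred: "0 < (p::real) \<Longrightarrow> p powr r = p * p powr (r - 1)"
  by (simp add: powr_diff)

lemma powr_succ: "0 < (p::real) \<Longrightarrow> p powr (r + 1) = p^2 * p powr (r - 1)"
  by (simp add: powr_diff powr_add power2_eq_square)

context dual_quant
begin

lemma interp_nonneg: "0 \<le> p \<Longrightarrow> 0 \<le> q \<Longrightarrow> 0 \<le> interp r p q"
  by (auto simp: interp_def)

lemma dinterp_nonneg: "0 < p \<Longrightarrow> 0 < q \<Longrightarrow> 0 \<le> dinterp r p q"
  using r_ge_1 by (auto simp: dinterp_def)

lemma interp_strict_mono:
  assumes "0 < p" "p < p'" "0 < q" shows "interp r p q < interp r p' q"
proof -
  \<comment> \<open>The first factor increases strictly in p, the second one weakly because r \<ge>
    1. This split also covers r = 1, where the second factor is constant in p.\<close>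
  have alt: "interp r p q = p / (p + q) * (q * (p powr (r - 1) + q powr (r - 1)))" if "0 < p" for p
    unfolding interp_def using powr_pred[OF that, of r] powr_pred[OF assms(3), of r]
    by (simp add: algebra_simps add_divide_distrib)
  have "p powr (r - 1) \<le> p' powr (r - 1)" using assms r_ge_1 by (intro powr_mono2) auto
  then have "q * (p powr (r - 1) + q powr (r - 1)) \<le> q * (p' powr (r - 1) + q powr (r - 1))"
    using assms by (intro mult_left_mono) auto
  moreover have "p / (p + q) < p' / (p' + q)"
    using assms by (simp add: divide_simps) (simp add: algebra_simps)
  moreover have "0 < q * (p powr (r - 1) + q powr (r - 1))" using assms by (auto intro!: mult_pos_pos add_pos_nonneg)
  ultimately show ?thesis unfolding alt[OF assms(1)] alt[OF less_trans[OF assms(1,2)]]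
    using assms by (intro mult_less_le_imp_less) auto
qed

lemma interp_mono:
  assumes "0 < p" "p \<le> p'" "0 < q" "q \<le> q'"
  shows "interp r p q \<le> interp r p' q'" and "p < p' \<or> q < q' \<Longrightarrow> interp r p q < interp r p' q'"
proof -
  have 1: "p = p' \<or> interp r p q < interp r p' q" using interp_strict_mono[of p p' q] assms by force
  have 2: "q = q' \<or> interp r p' q < interp r p' q'"
    using interp_strict_mono[of q q' p'] assms by (force simp: interp_commute[of r p'])
  show "interp r p q \<le> interp r p' q'" using 1 2 by auto
  show "p < p' \<or> q < q' \<Longrightarrow> interp r p q < interp r p' q'" using 1 2 by auto
qed

lemma interp_scale:
  assumes "0 < t" "0 \<le> p" "0 \<le> q" shows "interp r (t * p) (t * q) = t powr r * interp r p q"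
proof -
  have "interp r (t * p) (t * q) = (t * (t powr r * (p powr r * q + q powr r * p))) / (t * (p + q))"
    using assms unfolding interp_def by (simp add: powr_mult algebra_simps)
  then show ?thesis using assms by (simp add: interp_def)
qed

lemma interp_le:
  assumes "0 < p" "0 < q" shows "interp r p q \<le> 2 * (p + q) powr r"
proof -
  have "p powr r \<le> (p + q) powr r" "q powr r \<le> (p + q) powr r"
    using assms r_ge_1 by (auto intro: powr_mono2)
  then have "p powr r * q \<le> (p + q) powr r * (p + q)" "q powr r * p \<le> (p + q) powr r * (p + q)"
    using assms by (auto intro!: mult_mono)
  then have "p powr r * q + q powr r * p \<le> 2 * (p + q) powr r * (p + q)" by simp
  then show ?thesis using assms by (simp add: interp_def divide_simps)
qed

text \<open>This is the origin of \<open>Psi\<close>: it is the partial derivative of the local cost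
  on a cell of length 1, and a cell of length h contributes the degree r - 1 of homogeneity.\<close>

lemma dinterp_scale:
  assumes "0 < h" "0 < z" "z < 1"
  shows "dinterp r (h * z) (h * (1 - z)) = h powr (r - 1) * Psi r (1 - z)"
proof -
  define H where "H = h powr (r - 1)"
  have pw: "h powr r = h * H" "h powr (r + 1) = h^2 * H"
    unfolding H_def by (rule powr_pred[OF assms(1)] powr_succ[OF assms(1)])+
  have "(r - 1) * (h * z) powr r * (h * (1 - z)) + (h * (1 - z)) powr (r + 1) + r * (h * (1 - z))^2 * (h * z) powr (r - 1)
     = h^2 * (H * Psi r (1 - z))"
    unfolding Psi_reflect using assms
    by (simp add: powr_mult pw H_def[symmetric] power_mult_distrib) (simp add: power2_eq_square algebra_simps)
  moreover have "h * z + h * (1 - z) = h" by (simp add: algebra_simps)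
  ultimately show ?thesis unfolding dinterp_def H_def[symmetric] using assms by simp
qed

text \<open>Euler's identity for a function homogeneous of degree r. By the symmetry of
  \<open>interp\<close>, \<open>dinterp r q p\<close> is its partial derivative in the second
  argument.\<close>

lemma interp_euler:
  assumes "0 < p" "0 < q" shows "p * dinterp r p q + q * dinterp r q p = r * interp r p q"
proof -
  define X Y where "X = p powr (r - 1)" and "Y = q powr (r - 1)"
  have pw: "p powr r = p * X" "p powr (r + 1) = p^2 * X" "q powr r = q * Y" "q powr (r + 1) = q^2 * Y"
    unfolding X_def Y_def by (rule powr_pred[OF assms(1)] powr_succ[OF assms(1)] powr_pred[OF assms(2)] powr_succ[OF assms(2)])+
  have "p + q \<noteq> 0" using assms by simp
  then show ?thesis unfolding interp_def dinterp_def pw X_def[symmetric] Y_def[symmetric] add.commute[of q p]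
    by (simp add: divide_simps) (simp add: power2_eq_square algebra_simps)
qed

lemma interp_deriv_fst:
  assumes "s < x" "x < v"
  shows "((\<lambda>s. - interp r (x - s) (v - x)) has_real_derivative dinterp r (x - s) (v - x)) (at s)"
proof -
  define p q where "p = x - s" and "q = v - x"
  have pq: "0 < p" "0 < q" using assms by (auto simp: p_def q_def)
  define X Y where "X = p powr (r - 1)" and "Y = q powr (r - 1)"
  have pw: "p powr r = p * X" "p powr (r + 1) = p^2 * X" "q powr r = q * Y" "q powr (r + 1) = q^2 * Y"
    unfolding X_def Y_def by (rule powr_pred[OF pq(1)] powr_succ[OF pq(1)] powr_pred[OF pq(2)] powr_succ[OF pq(2)])+
  have "((\<lambda>s. - interp r (x - s) q) has_real_derivative
     - ((- (r * X * q) - q powr r) * (p + q) + (p powr r * q + q powr r * p)) / (p + q)^2) (at s)"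
    unfolding interp_def using pq
    by (auto intro!: derivative_eq_intros simp: p_def[symmetric] X_def[symmetric] power2_eq_square)
      (simp add: divide_simps)
  moreover have "- ((- (r * X * q) - q powr r) * (p + q) + (p powr r * q + q powr r * p)) / (p + q)^2 = dinterp r p q"
    unfolding dinterp_def pw X_def[symmetric] by (simp add: power2_eq_square algebra_simps)
  ultimately show ?thesis by (simp add: p_def q_def)
qed

lemma interp_deriv:
  assumes "u < x" "x < v"
  shows "((\<lambda>x. interp r (x - u) (v - x)) has_real_derivative dinterp r (x - u) (v - x) - dinterp r (v - x) (x - u)) (at x)"
proof -
  define p q where "p = x - u" and "q = v - x"
  have pq: "0 < p" "0 < q" using assms by (auto simp: p_def q_def)
  define X Y where "X = p powr (r - 1)" and "Y = q powr (r - 1)"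
  have pw: "p powr r = p * X" "p powr (r + 1) = p^2 * X" "q powr r = q * Y" "q powr (r + 1) = q^2 * Y"
    unfolding X_def Y_def by (rule powr_pred[OF pq(1)] powr_succ[OF pq(1)] powr_pred[OF pq(2)] powr_succ[OF pq(2)])+
  have 1: "(\<lambda>x. interp r (x - u) (v - x)) = (\<lambda>x. ((x - u) powr r * (v - x) + (v - x) powr r * (x - u)) / (p + q))"
    by (auto simp: interp_def p_def q_def)
  have "((\<lambda>x. interp r (x - u) (v - x)) has_real_derivative
     (r * X * q - p powr r + (q powr r - r * Y * p)) / (p + q)) (at x)"
    unfolding 1 using pq
    by (auto intro!: derivative_eq_intros simp: p_def[symmetric] q_def[symmetric] X_def[symmetric] Y_def[symmetric])
  moreover have "(r * X * q - p powr r + (q powr r - r * Y * p)) / (p + q) = dinterp r p q - dinterp r q p"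
    unfolding dinterp_def pw X_def[symmetric] Y_def[symmetric] add.commute[of q p] using pq
    by (simp add: divide_simps) (simp add: power2_eq_square algebra_simps)
  ultimately show ?thesis by (simp add: p_def q_def)
qed

definition cell_density :: "real \<Rightarrow> real \<Rightarrow> real \<Rightarrow> real \<Rightarrow> real" where
  "cell_density T u v x = indicator ({u<..<v} \<inter> {0<..<T}) x * (interp r (x - u) (v - x) * x powr (\<alpha> - 1))"

text \<open>Truncation at \<open>T\<close> lets a cell stick out of the interval \<open>[0, T]\<close> on either side, as the outer
  cells of a grid may; the induction over the cells needs every \<open>T\<close>.\<close>

definition cell :: "real \<Rightarrow> real \<Rightarrow> real \<Rightarrow> real" where
  "cell T u v = integral\<^sup>L lborel (cell_density T u v)"

lemma cell_density_measurable [measurable]: "cell_density T u v \<in> borel_measurable borel"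
  unfolding cell_density_def[abs_def] by measurable

lemma cell_density_nonneg: "0 \<le> cell_density T u v x"
  by (auto simp: cell_density_def indicator_def interp_nonneg)

lemma cell_nonneg: "0 \<le> cell T u v"
  by (simp add: cell_def cell_density_nonneg)

lemma powr_integrable:
  assumes "0 \<le> T" shows "integrable lborel (\<lambda>x. indicator {0<..<T} x * x powr (\<alpha> - 1))"
  using has_bochner_integral_Ioo[OF has_integral_powr_from_0[of "\<alpha> - 1" T]] alpha_pos assms
  by (auto intro: integrable.intros)

lemma cell_density_integrable: "integrable lborel (cell_density T u v)"
proof (cases "0 \<le> T")
  case True
  define B where "B = 2 * (v - u) powr r"
  show ?thesis
  proof (rule Bochner_Integration.integrable_bound)
    show "integrable lborel (\<lambda>x. B * (indicator {0<..<T} x * x powr (\<alpha> - 1)))"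
      using powr_integrable[OF True] by simp
    show "AE x in lborel. norm (cell_density T u v x) \<le> norm (B * (indicator {0<..<T} x * x powr (\<alpha> - 1)))"
    proof (rule AE_I2)
      fix x
      show "norm (cell_density T u v x) \<le> norm (B * (indicator {0<..<T} x * x powr (\<alpha> - 1)))"
      proof (cases "x \<in> {u<..<v} \<inter> {0<..<T}")
        case True
        then have "interp r (x - u) (v - x) \<le> B" using interp_le[of "x - u" "v - x"] by (auto simp: B_def)
        then have "interp r (x - u) (v - x) * x powr (\<alpha> - 1) \<le> B * x powr (\<alpha> - 1)" by (intro mult_right_mono) auto
        then show ?thesis using True interp_nonneg[of "x - u" "v - x"] by (simp add: cell_density_def B_def abs_mult)
      qed (simp add: cell_density_def)
    qed
  qed simp
next
  case False
  then have "cell_density T u v = (\<lambda>_. 0)" by (auto simp: cell_density_def indicator_def)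
  then show ?thesis by simp
qed

text \<open>The exponent collects r from \<open>interp_scale\<close>, \<alpha> - 1 from the density
  and 1 from the change of variables.\<close>

lemma cell_scale:
  assumes "0 < t" shows "cell (t * T) (t * u) (t * v) = t powr (r + \<alpha>) * cell T u v"
proof -
  have "cell (t * T) (t * u) (t * v) = \<bar>t\<bar> *\<^sub>R (\<integral>x. cell_density (t * T) (t * u) (t * v) (0 + t * x) \<partial>lborel)"
    unfolding cell_def using assms by (intro lborel_integral_real_affine) auto
  also have "(\<lambda>x. cell_density (t * T) (t * u) (t * v) (0 + t * x)) = (\<lambda>x. t powr (r + \<alpha> - 1) * cell_density T u v x)"
  proof
    fix x
    have "indicator ({t * u<..<t * v} \<inter> {0<..<t * T}) (t * x) = (indicator ({u<..<v} \<inter> {0<..<T}) x :: real)"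
      using assms by (auto simp: indicator_def zero_less_mult_iff)
    moreover have "interp r (t * x - t * u) (t * v - t * x) = t powr r * interp r (x - u) (v - x)" if "x \<in> {u<..<v}"
      using interp_scale[OF assms, of "x - u" "v - x"] that by (simp add: algebra_simps)
    ultimately show "cell_density (t * T) (t * u) (t * v) (0 + t * x) = t powr (r + \<alpha> - 1) * cell_density T u v x"
      using assms by (auto simp: cell_density_def indicator_def powr_mult powr_add[symmetric] algebra_simps)
  qed
  finally show ?thesis using assms by (simp add: cell_def powr_diff powr_add)
qed

text \<open>Pulling an outer grid point back to the boundary shortens the distances that enter
  \<open>interp\<close>, which increases strictly in each of them. The strict version forces the
  outer points of an optimal grid onto the boundary.\<close>

lemma cell_shrink:
  assumes "max u 0 < min v T"
  shows "cell T (max u 0) (min v T) \<le> cell T u v"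
    and "u < 0 \<or> T < v \<Longrightarrow> cell T (max u 0) (min v T) < cell T u v"
proof -
  define a b where "a = max u 0" and "b = min v T"
  have ab: "a < b" "u \<le> a" "b \<le> v" using assms by (auto simp: a_def b_def)
  have ind: "{u<..<v} \<inter> {0<..<T} = {a<..<b}" "{a<..<b} \<inter> {0<..<T} = {a<..<b}"
    by (auto simp: a_def b_def)
  have le: "cell_density T a b x \<le> cell_density T u v x" for x
    unfolding cell_density_def ind using interp_mono(1)[of "x - a" "x - u" "b - x" "v - x"] ab
    by (auto simp: indicator_def intro!: mult_right_mono)
  show "cell T (max u 0) (min v T) \<le> cell T u v"
    unfolding cell_def a_def[symmetric] b_def[symmetric] by (intro integral_mono cell_density_integrable le)
  assume "u < 0 \<or> T < v"
  then have "u < a \<or> b < v" by (auto simp: a_def b_def)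
  then have less: "cell_density T a b x < cell_density T u v x" if "a < x" "x < b" for x
    unfolding cell_density_def ind using interp_mono(2)[of "x - a" "x - u" "b - x" "v - x"] ab that
    by (auto simp: indicator_def a_def intro!: mult_strict_right_mono)
  show "cell T (max u 0) (min v T) < cell T u v"
    unfolding cell_def a_def[symmetric] b_def[symmetric]
    by (rule integral_strict_mono[OF cell_density_integrable cell_density_integrable le less ab(1)])
qed

lemma cell_empty: "T \<le> u \<Longrightarrow> cell T u v = 0"
proof -
  assume "T \<le> u"
  then have "cell_density T u v = (\<lambda>_. 0)" by (auto simp: cell_density_def indicator_def)
  then show ?thesis by (simp add: cell_def)
qed

lemma cell_truncate: "v \<le> S \<Longrightarrow> S \<le> T \<Longrightarrow> cell T u v = cell S u v"
proof -
  assume "v \<le> S" "S \<le> T"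
  then have "cell_density T u v = cell_density S u v" by (auto simp: cell_density_def indicator_def)
  then show ?thesis by (simp add: cell_def)
qed

section \<open>Integral formulas for chi and Euler's relation\<close>

text \<open>Substitute \<open>x = l + h * z\<close> with h = 1 - l. Taking l out of
  \<open>l + h * z\<close> leaves \<open>1 + z * (h / l)\<close>, and \<open>h / l\<close> is
  \<open>inverse l - 1\<close>.\<close>

lemma has_bochner_integral_dinterp_left:
  assumes "0 < l" "l < 1"
  shows "has_bochner_integral lborel (\<lambda>x. indicator {l<..<1} x * (dinterp r (x - l) (1 - x) * x powr (\<alpha> - 1)))
           (l powr (r + \<alpha> - 1) * chi r \<alpha> (inverse l - 1))"
proof -
  define h where "h = 1 - l"
  have h: "0 < h" "l = 1 - h" using assms by (auto simp: h_def)
  define y where "y = h / l"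
  have y: "0 < y" "inverse l - 1 = y" using assms by (auto simp: y_def h_def diff_divide_distrib inverse_eq_divide)
  define k where "k = integral\<^sup>L lborel (chi_kernel y)"
  have "has_bochner_integral lborel (\<lambda>z. h powr (r - 1) * l powr (\<alpha> - 1) * chi_kernel y z) (h powr (r - 1) * l powr (\<alpha> - 1) * k)"
    unfolding k_def
    by (rule has_bochner_integral_mult_right, rule has_bochner_integral_integrable, rule chi_kernel_integrable) (use y in simp)
  also have "(\<lambda>z. h powr (r - 1) * l powr (\<alpha> - 1) * chi_kernel y z) =
     (\<lambda>z. indicator {l<..<1} (l + h * z) * (dinterp r (l + h * z - l) (1 - (l + h * z)) * (l + h * z) powr (\<alpha> - 1)))"
  proof
    fix z
    have 1: "indicator {l<..<1} (l + h * z) = (indicator {0<..<1} z :: real)"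
      using h by (auto simp: indicator_def zero_less_mult_iff)
    have 2: "1 - (l + h * z) = h * (1 - z)" by (simp add: h(2) algebra_simps)
    have 3: "(l + h * z) powr (\<alpha> - 1) = l powr (\<alpha> - 1) * (1 + z * y) powr (\<alpha> - 1)" if "0 < z"
      using assms h y that by (subst powr_mult[symmetric]) (auto simp: y_def algebra_simps)
    show "h powr (r - 1) * l powr (\<alpha> - 1) * chi_kernel y z =
      indicator {l<..<1} (l + h * z) * (dinterp r (l + h * z - l) (1 - (l + h * z)) * (l + h * z) powr (\<alpha> - 1))"
    proof (cases "0 < z \<and> z < 1")
      case True
      then show ?thesis unfolding 1 2 chi_kernel_def using 3 dinterp_scale[OF h(1), of z] by simp
    next
      case False
      then have "indicator {0<..<1} z = (0::real)" by auto
      then show ?thesis unfolding 1 chi_kernel_def by simp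
    qed
  qed
  also have "h powr (r - 1) * l powr (\<alpha> - 1) * k = (l powr (r + \<alpha> - 1) * chi r \<alpha> y) /\<^sub>R \<bar>h\<bar>"
  proof -
    have "chi r \<alpha> y = h powr r / l powr r * k"
      using y assms h by (simp add: chi_eq k_def y_def powr_divide)
    then show ?thesis using assms h(1) by (simp add: powr_diff powr_add field_simps)
  qed
  finally show ?thesis unfolding y(2) using h(1)
    by (subst lborel_has_bochner_integral_real_affine_iff[where c = h and t = l]) auto
qed

text \<open>Now z measures the distance from the right end, hence the substitution
  \<open>x = 1 - h * z\<close> with its negative slope. The case l = 0 is included because the
  leftmost cell starts at 0.\<close>

lemma has_bochner_integral_dinterp_right:
  assumes "0 \<le> l" "l < 1"
  shows "has_bochner_integral lborel (\<lambda>x. indicator {l<..<1} x * (dinterp r (1 - x) (x - l) * x powr (\<alpha> - 1)))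
           (chi r \<alpha> (l - 1))"
proof -
  define h where "h = 1 - l"
  have h: "0 < h" "l = 1 - h" using assms by (auto simp: h_def)
  define k where "k = integral\<^sup>L lborel (chi_kernel (l - 1))"
  have "has_bochner_integral lborel (\<lambda>z. h powr (r - 1) * chi_kernel (l - 1) z) (h powr (r - 1) * k)"
    unfolding k_def
    by (rule has_bochner_integral_mult_right, rule has_bochner_integral_integrable, rule chi_kernel_integrable) (use assms in simp)
  also have "(\<lambda>z. h powr (r - 1) * chi_kernel (l - 1) z) =
     (\<lambda>z. indicator {l<..<1} (1 + (- h) * z) * (dinterp r (1 - (1 + (- h) * z)) (1 + (- h) * z - l) * (1 + (- h) * z) powr (\<alpha> - 1)))"
  proof
    fix z
    have 1: "indicator {l<..<1} (1 + (- h) * z) = (indicator {0<..<1} z :: real)"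
      using h by (auto simp: indicator_def zero_less_mult_iff)
    have 2: "1 - (1 + (- h) * z) = h * z" "1 + (- h) * z - l = h * (1 - z)" "1 + (- h) * z = 1 + z * (l - 1)"
      by (simp_all add: h(2) algebra_simps)
    show "h powr (r - 1) * chi_kernel (l - 1) z =
      indicator {l<..<1} (1 + (- h) * z) * (dinterp r (1 - (1 + (- h) * z)) (1 + (- h) * z - l) * (1 + (- h) * z) powr (\<alpha> - 1))"
    proof (cases "0 < z \<and> z < 1")
      case True
      then show ?thesis unfolding 1 2(1,2) unfolding 2(3) chi_kernel_def using dinterp_scale[OF h(1), of z] by simp
    next
      case False
      then have "indicator {0<..<1} z = (0::real)" by auto
      then show ?thesis unfolding 1 chi_kernel_def by simp
    qed
  qed
  also have "h powr (r - 1) * k = chi r \<alpha> (l - 1) /\<^sub>R \<bar>- h\<bar>"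
  proof -
    have "chi r \<alpha> (l - 1) = h powr r * k"
      using assms h by (simp add: chi_eq k_def)
    then show ?thesis using assms h(1) by (simp add: powr_diff field_simps)
  qed
  finally show ?thesis using h(1)
    by (subst lborel_has_bochner_integral_real_affine_iff[where c = "- h" and t = 1]) auto
qed

text \<open>Formally minus the derivative of \<open>cell 1 s 1\<close> in s;
  \<open>cell_eq_rate_integral\<close> gives the integrated form.\<close>

definition rate :: "real \<Rightarrow> real" where
  "rate s = indicator {0<..<1} s * (s powr (r + \<alpha> - 1) * chi r \<alpha> (inverse s - 1))"

lemma chi_nonneg: "-1 \<le> x \<Longrightarrow> 0 \<le> chi r \<alpha> x"
  using chi_pos[of x] by (cases "x = 0") (auto simp: chi_def)

lemma chi_zero: "chi r \<alpha> 0 = 0"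
  by (simp add: chi_def)

lemma chi_mono: "0 \<le> x \<Longrightarrow> x \<le> y \<Longrightarrow> chi r \<alpha> x \<le> chi r \<alpha> y"
  using chi_strict_mono[of x y] chi_nonneg[of y] chi_zero by (cases "x = 0"; cases "x = y") auto

lemma inverse_ge: "0 < s \<Longrightarrow> s \<le> 1 \<Longrightarrow> 0 \<le> inverse s - (1::real)"
  by (simp add: one_le_inverse)

lemma rate_measurable [measurable]: "rate \<in> borel_measurable borel"
proof -
  have "continuous_on {0<..<1} (\<lambda>s. s powr (r + \<alpha> - 1) * chi r \<alpha> (inverse s - 1))"
    by (intro continuous_intros continuous_on_compose2[OF chi_continuous]) (auto simp: one_less_inverse)
  then have "(\<lambda>s. indicator {0<..<1} s *\<^sub>R (s powr (r + \<alpha> - 1) * chi r \<alpha> (inverse s - 1))) \<in> borel_measurable borel"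
    by (intro borel_measurable_continuous_on_indicator) auto
  then show ?thesis by (simp add: rate_def[abs_def])
qed

text \<open>Fundamental theorem in the left grid point s, which travels from u to x. The local cost
  vanishes when s reaches x, so the integral is the whole local cost. Nonnegative integrals are used
  so that Tonelli applies directly.\<close>

lemma cell_density_eq_integral:
  assumes "0 < u"
  shows "ennreal (cell_density 1 u 1 x) =
    (\<integral>\<^sup>+s. ennreal (indicator {u<..<x} s * indicator {..<1} x * (dinterp r (x - s) (1 - x) * x powr (\<alpha> - 1))) \<partial>lborel)"
proof (cases "u < x \<and> x < 1")
  case True
  have "((\<lambda>s. dinterp r (x - s) (1 - x)) has_integral (- interp r (x - x) (1 - x) - - interp r (x - u) (1 - x))) {u..x}"
  proof (rule fundamental_theorem_of_calculus_interior)
    show "continuous_on {u..x} (\<lambda>s. - interp r (x - s) (1 - x))"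
      unfolding interp_def using True r_ge_1
      by (intro continuous_on_minus continuous_on_mult continuous_on_divide continuous_on_add continuous_on_powr'
          continuous_on_diff continuous_on_id continuous_on_const) auto
  qed (use True interp_deriv_fst[of _ x 1] in \<open>auto simp: has_real_derivative_iff_has_vector_derivative\<close>)
  moreover have "interp r (x - x) (1 - x) = 0" by (simp add: interp_def)
  ultimately have "((\<lambda>s. dinterp r (x - s) (1 - x) * x powr (\<alpha> - 1)) has_integral (interp r (x - u) (1 - x) * x powr (\<alpha> - 1))) {u..x}"
    by (intro has_integral_mult_left) simp
  then have "has_bochner_integral lborel (\<lambda>s. indicator {u<..<x} s * (dinterp r (x - s) (1 - x) * x powr (\<alpha> - 1)))
      (interp r (x - u) (1 - x) * x powr (\<alpha> - 1))"
    by (rule has_bochner_integral_Ioo) (use True dinterp_nonneg in auto)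
  then have "(\<integral>\<^sup>+s. ennreal (indicator {u<..<x} s * (dinterp r (x - s) (1 - x) * x powr (\<alpha> - 1))) \<partial>lborel)
    = ennreal (interp r (x - u) (1 - x) * x powr (\<alpha> - 1))"
    unfolding has_bochner_integral_iff
    by (subst nn_integral_eq_integral) (use True dinterp_nonneg in \<open>auto simp: indicator_def\<close>)
  then show ?thesis using True assms by (simp add: cell_density_def)
next
  case False
  then have "indicator {u<..<x} s * indicator {..<1} x * (dinterp r (x - s) (1 - x) * x powr (\<alpha> - 1)) = 0" for s
    by (auto simp: indicator_def)
  moreover have "cell_density 1 u 1 x = 0" using False by (auto simp: cell_density_def)
  ultimately show ?thesis by (simp only: ennreal_0 nn_integral_const mult_zero_left)
qed

lemma cell_eq_rate_integral:
  assumes "0 < u"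
  shows "ennreal (cell 1 u 1) = (\<integral>\<^sup>+s. ennreal (rate s) * indicator {u<..1} s \<partial>lborel)"
proof -
  define H where "H s x = ennreal (indicator {u<..<x} s * indicator {..<1} x * (dinterp r (x - s) (1 - x) * x powr (\<alpha> - 1)))" for s x
  \<comment> \<open>The bounds of the first indicator depend on x; as one condition on the pair (s,
    x) the integrand is visibly jointly measurable.\<close>
  have H_alt: "H s x = ennreal ((if u < s \<and> s < x \<and> x < 1 then 1 else 0) * (dinterp r (x - s) (1 - x) * x powr (\<alpha> - 1)))" for s x
    by (auto simp: H_def indicator_def)
  have [measurable]: "case_prod H \<in> borel_measurable (lborel \<Otimes>\<^sub>M lborel)"
    unfolding H_alt[abs_def] split_beta' by measurable
  have "ennreal (cell 1 u 1) = (\<integral>\<^sup>+x. ennreal (cell_density 1 u 1 x) \<partial>lborel)"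
    unfolding cell_def by (intro nn_integral_eq_integral[symmetric] cell_density_integrable AE_I2 cell_density_nonneg)
  also have "\<dots> = (\<integral>\<^sup>+x. \<integral>\<^sup>+s. H s x \<partial>lborel \<partial>lborel)"
    unfolding H_def using cell_density_eq_integral[OF assms] by simp
  also have "\<dots> = (\<integral>\<^sup>+s. \<integral>\<^sup>+x. H s x \<partial>lborel \<partial>lborel)"
    by (rule lborel_pair.Fubini') simp
  also have "\<dots> = (\<integral>\<^sup>+s. ennreal (rate s) * indicator {u<..1} s \<partial>lborel)"
  proof (intro nn_integral_cong)
    fix s :: real
    show "(\<integral>\<^sup>+x. H s x \<partial>lborel) = ennreal (rate s) * indicator {u<..1} s"
    proof (cases "u < s \<and> s < 1")
      case True
      have "H s x = ennreal (indicator {s<..<1} x * (dinterp r (x - s) (1 - x) * x powr (\<alpha> - 1)))" for x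
        using True by (auto simp: H_def indicator_def)
      moreover have "(\<integral>\<^sup>+x. ennreal (indicator {s<..<1} x * (dinterp r (x - s) (1 - x) * x powr (\<alpha> - 1))) \<partial>lborel) =
        ennreal (s powr (r + \<alpha> - 1) * chi r \<alpha> (inverse s - 1))"
        using has_bochner_integral_dinterp_left[of s] True assms unfolding has_bochner_integral_iff
        by (subst nn_integral_eq_integral) (auto simp: indicator_def dinterp_nonneg)
      ultimately show ?thesis using True assms by (simp add: rate_def)
    next
      case False
      then have "H s x = 0" for x by (auto simp: H_def indicator_def)
      then show ?thesis using False by (auto simp: rate_def indicator_def)
    qed
  qed
  finally show ?thesis .
qed

lemma powr_nn_integral:
  assumes "0 < u" "u \<le> v" "0 \<le> c"
  shows "(\<integral>\<^sup>+s. ennreal (c * s powr (r + \<alpha> - 1)) * indicator {u<..v} s \<partial>lborel)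
    = ennreal (c * (v powr (r + \<alpha>) - u powr (r + \<alpha>)) / (r + \<alpha>))"
proof -
  have rho: "0 < r + \<alpha>" using r_ge_1 alpha_pos by simp
  have "(\<integral>\<^sup>+s. ennreal (c * s powr (r + \<alpha> - 1)) * indicator {u<..v} s \<partial>lborel)
      = (\<integral>\<^sup>+s. ennreal (c * s powr (r + \<alpha> - 1)) * indicator {u..v} s \<partial>lborel)"
    by (intro nn_integral_cong_AE) (use AE_lborel_singleton[of u] in eventually_elim, auto simp: indicator_def)
  also have "\<dots> = ennreal (c * v powr (r + \<alpha>) / (r + \<alpha>) - c * u powr (r + \<alpha>) / (r + \<alpha>))"
    using assms rho by (intro nn_integral_FTC_Icc[where F = "\<lambda>s. c * s powr (r + \<alpha>) / (r + \<alpha>)"])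
      (auto intro!: derivative_eq_intros)
  finally show ?thesis by (simp add: right_diff_distrib diff_divide_distrib)
qed

text \<open>Substitute for a derivative: \<open>chi r \<alpha> (inverse s - 1)\<close> decreases in
  s, so on \<open>{u<..v}\<close> it lies between its values at v and at u, and only
  \<open>s powr (r + \<alpha> - 1)\<close> is left to integrate.\<close>

lemma cell_difference:
  assumes "0 < u" "u \<le> v" "v \<le> 1"
  shows "chi r \<alpha> (inverse v - 1) * (v powr (r + \<alpha>) - u powr (r + \<alpha>)) / (r + \<alpha>) \<le> cell 1 u 1 - cell 1 v 1"
    and "cell 1 u 1 - cell 1 v 1 \<le> chi r \<alpha> (inverse u - 1) * (v powr (r + \<alpha>) - u powr (r + \<alpha>)) / (r + \<alpha>)"
proof -
  have rho: "0 < r + \<alpha>" using r_ge_1 alpha_pos by simp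
  have pw: "u powr (r + \<alpha>) \<le> v powr (r + \<alpha>)" using assms rho by (intro powr_mono2) auto
  let ?I = "\<integral>\<^sup>+s. ennreal (rate s) * indicator {u<..v} s \<partial>lborel"
  have "ennreal (cell 1 u 1) = (\<integral>\<^sup>+s. ennreal (rate s) * indicator {u<..v} s + ennreal (rate s) * indicator {v<..1} s \<partial>lborel)"
    unfolding cell_eq_rate_integral[OF assms(1)]
    using assms by (intro nn_integral_cong) (auto simp: indicator_def)
  also have "\<dots> = ?I + ennreal (cell 1 v 1)"
    using assms by (subst nn_integral_add) (auto simp: cell_eq_rate_integral)
  finally have split: "ennreal (cell 1 u 1) = ?I + ennreal (cell 1 v 1)" .
  define cv cu where "cv = chi r \<alpha> (inverse v - 1)" and "cu = chi r \<alpha> (inverse u - 1)"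
  have c0: "0 \<le> cv" "0 \<le> cu" unfolding cv_def cu_def
    using assms by (auto intro!: chi_nonneg order_trans[OF _ inverse_ge])
  have lo: "ennreal (cv * s powr (r + \<alpha> - 1)) * indicator {u<..v} s \<le> ennreal (rate s) * indicator {u<..v} s"
   and hi: "ennreal (rate s) * indicator {u<..v} s \<le> ennreal (cu * s powr (r + \<alpha> - 1)) * indicator {u<..v} s" for s
  proof -
    have "cv * s powr (r + \<alpha> - 1) \<le> rate s \<and> rate s \<le> cu * s powr (r + \<alpha> - 1)" if s: "u < s" "s \<le> v"
    \<comment> \<open>At s = 1 \<open>rate\<close> is 0 by its indicator. This happens only for v =
      1, where the lower bound is 0 as well.\<close>
    proof (cases "s = 1")
      case True
      then have "v = 1" using s assms by simp
      then show ?thesis using True c0 by (simp add: cv_def rate_def chi_zero)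
    next
      case False
      then have s1: "0 < s" "s < 1" using s assms by auto
      have "cv \<le> chi r \<alpha> (inverse s - 1)" unfolding cv_def
        using s s1 assms by (intro chi_mono inverse_ge) (auto intro: le_imp_inverse_le)
      moreover have "chi r \<alpha> (inverse s - 1) \<le> cu" unfolding cu_def
        using s s1 assms by (intro chi_mono inverse_ge) (auto intro: le_imp_inverse_le)
      ultimately show ?thesis using s1 by (auto simp: rate_def mult.commute intro!: mult_left_mono)
    qed
    then show "ennreal (cv * s powr (r + \<alpha> - 1)) * indicator {u<..v} s \<le> ennreal (rate s) * indicator {u<..v} s"
     "ennreal (rate s) * indicator {u<..v} s \<le> ennreal (cu * s powr (r + \<alpha> - 1)) * indicator {u<..v} s"
      by (auto simp: indicator_def intro!: ennreal_leI)
  qed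
  have L: "ennreal (cv * (v powr (r + \<alpha>) - u powr (r + \<alpha>)) / (r + \<alpha>)) \<le> ?I"
    unfolding powr_nn_integral[OF assms(1,2) c0(1), symmetric] by (intro nn_integral_mono lo)
  have U: "?I \<le> ennreal (cu * (v powr (r + \<alpha>) - u powr (r + \<alpha>)) / (r + \<alpha>))"
    unfolding powr_nn_integral[OF assms(1,2) c0(2), symmetric] by (intro nn_integral_mono hi)
  have n: "0 \<le> cv * (v powr (r + \<alpha>) - u powr (r + \<alpha>)) / (r + \<alpha>)" "0 \<le> cu * (v powr (r + \<alpha>) - u powr (r + \<alpha>)) / (r + \<alpha>)"
    using c0 pw rho by auto
  have "ennreal (cv * (v powr (r + \<alpha>) - u powr (r + \<alpha>)) / (r + \<alpha>) + cell 1 v 1) \<le> ennreal (cell 1 u 1)"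
    unfolding split using L n cell_nonneg by (auto simp: ennreal_plus intro: add_right_mono)
  then show "chi r \<alpha> (inverse v - 1) * (v powr (r + \<alpha>) - u powr (r + \<alpha>)) / (r + \<alpha>) \<le> cell 1 u 1 - cell 1 v 1"
    using cell_nonneg[of 1 u 1] by (simp add: cv_def)
  have "ennreal (cell 1 u 1) \<le> ennreal (cu * (v powr (r + \<alpha>) - u powr (r + \<alpha>)) / (r + \<alpha>) + cell 1 v 1)"
    unfolding split using U n cell_nonneg by (auto simp: ennreal_plus intro: add_right_mono)
  then show "cell 1 u 1 - cell 1 v 1 \<le> chi r \<alpha> (inverse u - 1) * (v powr (r + \<alpha>) - u powr (r + \<alpha>)) / (r + \<alpha>)"
    using cell_nonneg[of 1 v 1] n by (subst (asm) ennreal_le_iff) (auto simp: cu_def)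
qed

text \<open>Integrate the derivative of \<open>interp r (x - l) (1 - x) * x powr \<alpha>\<close>
  over \<open>[l, 1]\<close>: the boundary terms vanish since the local cost is 0 at both grid
  points. Writing x as \<open>(x - l) + l\<close> and as \<open>1 - (1 - x)\<close> in front of the
  two partial derivatives, \<open>interp_euler\<close> turns the integrand into the cell density and
  the integrands of the two formulas for chi.\<close>

lemma cell_euler:
  assumes "0 \<le> l" "l < 1"
  shows "(r + \<alpha>) * cell 1 l 1 = chi r \<alpha> (l - 1) - l powr (r + \<alpha>) * chi r \<alpha> (inverse l - 1)"
proof -
  define fA where "fA x = indicator {l<..<1} x * (dinterp r (x - l) (1 - x) * x powr (\<alpha> - 1))" for x
  define fB where "fB x = indicator {l<..<1} x * (dinterp r (1 - x) (x - l) * x powr (\<alpha> - 1))" for x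
  have A: "has_bochner_integral lborel (\<lambda>x. l * fA x) (l powr (r + \<alpha>) * chi r \<alpha> (inverse l - 1))"
  proof (cases "l = 0")
    case False
    have "has_bochner_integral lborel (\<lambda>x. l * fA x) (l * (l powr (r + \<alpha> - 1) * chi r \<alpha> (inverse l - 1)))"
      unfolding fA_def
      by (rule has_bochner_integral_mult_right, rule has_bochner_integral_dinterp_left) (use assms False in auto)
    also have "l * (l powr (r + \<alpha> - 1) * chi r \<alpha> (inverse l - 1)) = l powr (r + \<alpha>) * chi r \<alpha> (inverse l - 1)"
      using assms False by (simp add: powr_diff)
    finally show ?thesis .
  qed (simp add: has_bochner_integral_zero)
  have B: "has_bochner_integral lborel fB (chi r \<alpha> (l - 1))"
    unfolding fB_def using assms by (rule has_bochner_integral_dinterp_right)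
  have C: "has_bochner_integral lborel (\<lambda>x. (r + \<alpha>) * cell_density 1 l 1 x) ((r + \<alpha>) * cell 1 l 1)"
    unfolding cell_def
    by (rule has_bochner_integral_mult_right, rule has_bochner_integral_integrable, rule cell_density_integrable)
  define D where "D x = (dinterp r (x - l) (1 - x) - dinterp r (1 - x) (x - l)) * x powr \<alpha>
     + interp r (x - l) (1 - x) * (\<alpha> * x powr (\<alpha> - 1))" for x
  define F where "F x = interp r (x - l) (1 - x) * x powr \<alpha>" for x
  have "(D has_integral (F 1 - F l)) {l..1}"
  proof (rule fundamental_theorem_of_calculus_interior)
    show "continuous_on {l..1} F"
      unfolding F_def interp_def using assms r_ge_1 alpha_pos
      by (intro continuous_on_mult continuous_on_divide continuous_on_add continuous_on_powr' continuous_on_diff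
          continuous_on_id continuous_on_const) auto
    show "(F has_vector_derivative D x) (at x)" if "x \<in> {l<..<1}" for x
      unfolding F_def D_def has_real_derivative_iff_has_vector_derivative[symmetric]
      using that assms by (auto intro!: derivative_eq_intros interp_deriv)
  qed (use assms in simp)
  moreover have "F 1 - F l = 0" by (simp add: F_def interp_def)
  ultimately have "((\<lambda>x. if x \<in> {l<..<1} then D x else 0) has_integral 0) UNIV"
    by (simp only: has_integral_restrict_UNIV has_integral_Icc_iff_Ioo)
  also have "(\<lambda>x. if x \<in> {l<..<1} then D x else 0) = (\<lambda>x. (r + \<alpha>) * cell_density 1 l 1 x + l * fA x - fB x)"
  proof
    fix x
    show "(if x \<in> {l<..<1} then D x else 0) = (r + \<alpha>) * cell_density 1 l 1 x + l * fA x - fB x"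
    proof (cases "x \<in> {l<..<1}")
      case True
      then have x: "0 < x" "l < x" "x < 1" using assms by auto
      define d e where "d = dinterp r (x - l) (1 - x)" and "e = dinterp r (1 - x) (x - l)"
      have eu: "r * interp r (x - l) (1 - x) = (x - l) * d + (1 - x) * e"
        unfolding d_def e_def using interp_euler[of "x - l" "1 - x"] x by simp
      have pw: "x powr \<alpha> = x * x powr (\<alpha> - 1)" using x by (intro powr_pred)
      have "D x = x powr (\<alpha> - 1) * ((d - e) * x + \<alpha> * interp r (x - l) (1 - x))"
        unfolding D_def pw d_def e_def by (simp add: algebra_simps)
      also have "(d - e) * x + \<alpha> * interp r (x - l) (1 - x) = (r + \<alpha>) * interp r (x - l) (1 - x) + l * d - e"
        using eu by (simp add: algebra_simps)
      finally show ?thesis using x by (simp add: fA_def fB_def d_def e_def cell_density_def algebra_simps)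
    qed (use assms in \<open>auto simp: fA_def fB_def cell_density_def indicator_def\<close>)
  qed
  finally have 0: "((\<lambda>x. (r + \<alpha>) * cell_density 1 l 1 x + l * fA x - fB x) has_integral 0) UNIV" .
  have "has_bochner_integral lborel (\<lambda>x. (r + \<alpha>) * cell_density 1 l 1 x + l * fA x - fB x)
     ((r + \<alpha>) * cell 1 l 1 + l powr (r + \<alpha>) * chi r \<alpha> (inverse l - 1) - chi r \<alpha> (l - 1))"
    by (intro has_bochner_integral_diff has_bochner_integral_add A B C)
  then have "((\<lambda>x. (r + \<alpha>) * cell_density 1 l 1 x + l * fA x - fB x) has_integral
     ((r + \<alpha>) * cell 1 l 1 + l powr (r + \<alpha>) * chi r \<alpha> (inverse l - 1) - chi r \<alpha> (l - 1))) UNIV"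
    unfolding has_bochner_integral_iff by (elim conjE) (drule has_integral_integral_lborel, simp only:)
  from has_integral_unique[OF this 0] show ?thesis by simp
qed

section \<open>The Bellman equation and its strict minimiser\<close>

text \<open>The closed form serves as the definition. That it is the optimal cost with n cells
  follows from \<open>total_cost_lower_bound\<close> and \<open>total_cost_attained\<close>.\<close>

definition opt_value :: "nat \<Rightarrow> real" where
  "opt_value n = chi r \<alpha> (G n - 1) / (r + \<alpha>)"

lemma opt_value_1: "opt_value 1 = cell 1 0 1"
proof -
  have "(r + \<alpha>) * cell 1 0 1 = chi r \<alpha> (-1)" using cell_euler[of 0] by simp
  then show ?thesis using r_ge_1 alpha_pos unfolding opt_value_def by (simp add: nonzero_divide_eq_eq mult.commute)
qed

lemma opt_value_Suc:
  assumes "n \<ge> 1"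
  shows "opt_value (Suc n) = cell 1 (G (Suc n)) 1 + G (Suc n) powr (r + \<alpha>) * opt_value n"
proof -
  have G: "0 \<le> G (Suc n)" "G (Suc n) < 1" using G_bounds[of "Suc n"] by auto
  define rho where "rho = r + \<alpha>"
  have rho: "0 < rho" using r_ge_1 alpha_pos by (simp add: rho_def)
  have "chi r \<alpha> (inverse (G (Suc n)) - 1) = rho * opt_value n"
    unfolding G_eq[OF assms] opt_value_def using rho by (simp add: rho_def)
  moreover have "chi r \<alpha> (G (Suc n) - 1) = rho * opt_value (Suc n)"
    unfolding opt_value_def using rho by (simp add: rho_def)
  ultimately have "rho * opt_value (Suc n) = rho * (cell 1 (G (Suc n)) 1 + G (Suc n) powr rho * opt_value n)"
    using cell_euler[OF G, folded rho_def] by (simp add: algebra_simps)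
  then show ?thesis using rho by (simp add: rho_def)
qed

text \<open>Formally the derivative in l of the right-hand side is a positive multiple of
  \<open>chi r \<alpha> (G n - 1) - chi r \<alpha> (inverse l - 1)\<close>, which changes sign once,
  from negative to positive, at \<open>G (Suc n)\<close>. \<open>cell_difference\<close> expresses
  this without derivatives.\<close>

lemma opt_value_less:
  assumes n: "n \<ge> 1" and l: "0 < l" "l \<le> 1"
    and ne: "l \<noteq> G (Suc n)"
  shows "opt_value (Suc n) < cell 1 l 1 + l powr (r + \<alpha>) * opt_value n"
proof -
  define g where "g = G (Suc n)"
  have g: "0 < g" "g < 1" using G_pos[of "Suc n"] G_bounds[of "Suc n"] n by (auto simp: g_def)
  define c where "c = chi r \<alpha> (G n - 1)"
  have c: "chi r \<alpha> (inverse g - 1) = c" using G_eq[OF n] by (simp add: g_def c_def)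
  define rho where "rho = r + \<alpha>"
  have rho: "0 < rho" using r_ge_1 alpha_pos by (simp add: rho_def)
  define f where "f l = rho * cell 1 l 1 + l powr rho * c" for l
  have key: "f g < f l"
  proof (cases "l < g")
    case True
    \<comment> \<open>\<open>cell_difference\<close> gives weak inequalities only, with the critical
      value c at g. Cutting at the midpoint gains strictness on the half away from g.\<close>
    define m where "m = (l + g) / 2"
    have m: "l < m" "m < g" using True by (auto simp: m_def)
    have "c < chi r \<alpha> (inverse m - 1)" unfolding c[symmetric]
      using m g l by (intro chi_strict_mono) (auto simp: one_less_inverse)
    moreover have "l powr rho < m powr rho" using m l rho by (intro powr_less_mono2) auto
    ultimately have 1: "c * (m powr rho - l powr rho) < chi r \<alpha> (inverse m - 1) * (m powr rho - l powr rho)"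
      by (intro mult_strict_right_mono) auto
    have "chi r \<alpha> (inverse m - 1) * (m powr rho - l powr rho) \<le> rho * (cell 1 l 1 - cell 1 m 1)"
      using cell_difference(1)[of l m] l m g rho by (simp add: rho_def[symmetric] pos_divide_le_eq pos_le_divide_eq mult.commute)
    moreover have "c * (g powr rho - m powr rho) \<le> rho * (cell 1 m 1 - cell 1 g 1)"
      using cell_difference(1)[of m g] l m g rho by (simp add: rho_def[symmetric] c pos_divide_le_eq pos_le_divide_eq mult.commute)
    ultimately show ?thesis using 1 unfolding f_def by (simp add: algebra_simps)
  next
    case False
    then have gl: "g < l" using ne by (simp add: g_def)
    define m where "m = (l + g) / 2"
    have m: "g < m" "m < l" using gl by (auto simp: m_def)
    have "chi r \<alpha> (inverse m - 1) < c" unfolding c[symmetric]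
      using m g l by (intro chi_strict_mono) (auto simp: one_less_inverse)
    moreover have "m powr rho < l powr rho" using m l g rho by (intro powr_less_mono2) auto
    ultimately have 1: "chi r \<alpha> (inverse m - 1) * (l powr rho - m powr rho) < c * (l powr rho - m powr rho)"
      by (intro mult_strict_right_mono) auto
    have "rho * (cell 1 m 1 - cell 1 l 1) \<le> chi r \<alpha> (inverse m - 1) * (l powr rho - m powr rho)"
      using cell_difference(2)[of m l] l m g rho by (simp add: rho_def[symmetric] pos_divide_le_eq pos_le_divide_eq mult.commute)
    moreover have "rho * (cell 1 g 1 - cell 1 m 1) \<le> c * (m powr rho - g powr rho)"
      using cell_difference(2)[of g m] l m g rho by (simp add: rho_def[symmetric] c pos_divide_le_eq pos_le_divide_eq mult.commute)
    ultimately show ?thesis using 1 unfolding f_def by (simp add: algebra_simps)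
  qed
  have "rho * opt_value n = c" using rho by (simp add: opt_value_def c_def rho_def[symmetric])
  then have f: "f l = rho * (cell 1 l 1 + l powr rho * opt_value n)" for l
    by (simp only: f_def distrib_left mult.left_commute[of rho])
  have "rho * opt_value (Suc n) = f g" unfolding f using opt_value_Suc[OF n] by (simp add: g_def rho_def)
  then have "rho * opt_value (Suc n) < rho * (cell 1 l 1 + l powr rho * opt_value n)" using key f by metis
  then show ?thesis using rho by (simp add: rho_def)
qed

text \<open>The choice l = 1 leaves the last cell empty, and it is not the minimiser because
  \<open>G (Suc n) < 1\<close>. Hence optimal grids use every point allowed.\<close>

lemma opt_value_decr: "n \<ge> 1 \<Longrightarrow> opt_value (Suc n) < opt_value n"
proof -
  assume n: "n \<ge> 1"
  have "cell 1 1 1 = 0" by (rule cell_empty) simp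
  then show ?thesis using opt_value_less[OF n, of 1] G_bounds[of "Suc n"] by simp
qed

lemma opt_value_antimono: "1 \<le> m \<Longrightarrow> m < n \<Longrightarrow> opt_value n < opt_value m"
proof (induction n)
  case (Suc n)
  show ?case
  proof (cases "m = n")
    case False
    then have "opt_value n < opt_value m" using Suc by simp
    then show ?thesis using opt_value_decr[of n] Suc by simp
  qed (use opt_value_decr[of m] Suc in simp)
qed simp

section \<open>The dynamic program\<close>

definition total_cost :: "real \<Rightarrow> nat \<Rightarrow> (nat \<Rightarrow> real) \<Rightarrow> real" where
  "total_cost T n y = (\<Sum>i<n. cell T (y i) (y (Suc i)))"

lemma total_cost_nonneg: "0 \<le> total_cost T n y"
  by (simp add: total_cost_def sum_nonneg cell_nonneg)

lemma total_cost_Suc: "total_cost T (Suc n) y = total_cost T n y + cell T (y n) (y (Suc n))"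
  by (simp add: total_cost_def)

lemma total_cost_truncate:
  assumes "\<And>i. i \<le> n \<Longrightarrow> y i \<le> S" "S \<le> T" shows "total_cost T n y = total_cost S n y"
  unfolding total_cost_def using assms by (intro sum.cong cell_truncate) auto

lemma cell_normalize:
  assumes "0 < T" shows "cell T (T * l) T = T powr (r + \<alpha>) * cell 1 l 1"
  using cell_scale[OF assms, of 1 l 1] by simp

text \<open>Induction by removal of the last grid point, split by where its predecessor p lies
  relative to 0 and T. The remaining cells face the same problem with p in place of T, so T must
  vary. Uniqueness is carried along, since equality for \<open>Suc n\<close> cells forces equality
  for the first n.\<close>

lemma total_cost_lower_bound:
  assumes "strict_mono_on {..n} y" "y 0 \<le> 0" "0 < T" "T \<le> y n"
  shows "T powr (r + \<alpha>) * opt_value n \<le> total_cost T n y \<and>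
    (total_cost T n y = T powr (r + \<alpha>) * opt_value n \<longrightarrow> (\<forall>i\<le>n. y i = T * (\<Prod>j=Suc i..n. G j)))"
  using assms
proof (induction n arbitrary: T)
  case 0
  then show ?case by simp
next
  case (Suc n)
  define p q where "p = y n" and "q = y (Suc n)"
  have pq: "p < q" unfolding p_def q_def by (rule strict_mono_onD[OF Suc.prems(1)]) auto
  have Tq: "T \<le> q" using Suc.prems by (simp add: q_def)
  have sm: "strict_mono_on {..n} y" using Suc.prems(1) by (auto simp: strict_mono_on_def)
  have T: "0 < T" by fact
  define P where "P = T powr (r + \<alpha>)"
  have P: "0 < P" using T by (simp add: P_def)
  have total: "total_cost T (Suc n) y = total_cost T n y + cell T p q"
    by (simp add: total_cost_Suc p_def q_def)
  consider "p \<le> 0" | "T \<le> p" | "0 < p" "p < T" by linarith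
  then show ?case
  proof cases
    \<comment> \<open>The last cell alone covers \<open>[0, T]\<close>, which costs at least the
      one-cell optimum. The genuine base of the induction, n = 0 with the points 0 and T, sits here;
      without any cell the hypotheses are contradictory.\<close>
    case 1
    have m: "max p 0 = 0" "min q T = T" using 1 Tq by auto
    have c0: "cell T 0 T = P * opt_value 1"
      unfolding opt_value_1 P_def using cell_normalize[OF T, of 0] by simp
    have c: "P * opt_value 1 \<le> cell T p q" "p < 0 \<or> T < q \<Longrightarrow> P * opt_value 1 < cell T p q"
      using cell_shrink[of p q T, unfolded m c0] T by auto
    show ?thesis
    proof (cases "n = 0")
      case True
      have "y i = T * (\<Prod>j=Suc i..Suc n. G j)" if "total_cost T (Suc n) y = P * opt_value (Suc n)" "i \<le> Suc n" for i
      proof -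
        have "cell T p q = P * opt_value 1" using that(1) True total by (simp add: total_cost_def)
        then have "\<not> (p < 0 \<or> T < q)" using c(2) by auto
        then have "y 0 = 0" "y 1 = T" using 1 Tq True by (auto simp: p_def q_def)
        moreover have "i = 0 \<or> i = 1" using that(2) True by auto
        ultimately show ?thesis using True by auto
      qed
      then show ?thesis using c(1) True total total_cost_nonneg[of T n y] by (auto simp: P_def)
    next
      case False
      then have "opt_value (Suc n) < opt_value 1" by (intro opt_value_antimono) auto
      then have "P * opt_value (Suc n) < P * opt_value 1" using P by simp
      then have "P * opt_value (Suc n) < total_cost T (Suc n) y"
        using c(1) total total_cost_nonneg[of T n y] by linarith
      then show ?thesis by (simp add: P_def)
    qed
  next
    \<comment> \<open>The last cell lies beyond T and is wasted: the first n cells already cover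
      \<open>[0, T]\<close>.\<close>
    case 2
    have n: "1 \<le> n" using 2 T Suc.prems(2) by (cases n) (auto simp: p_def)
    have "P * opt_value n \<le> total_cost T n y"
      using Suc.IH[OF sm Suc.prems(2) T] 2 by (simp add: P_def p_def)
    moreover have "P * opt_value (Suc n) < P * opt_value n" using opt_value_decr[OF n] P by simp
    ultimately have "P * opt_value (Suc n) < total_cost T (Suc n) y"
      using total cell_nonneg[of T p q] by linarith
    then show ?thesis by (simp add: P_def)
  next
    case 3
    have n: "1 \<le> n" using 3 Suc.prems(2) by (cases n) (auto simp: p_def)
    have "y i \<le> p" if "i \<le> n" for i
      unfolding p_def using strict_mono_on_leD[OF sm, of i n] that by auto
    \<comment> \<open>The first n cells end at p, so lowering the truncation to p changes nothing,
      and the induction hypothesis applies with p for T.\<close>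
    then have trunc: "total_cost T n y = total_cost p n y"
      using 3 by (intro total_cost_truncate) auto
    have IH: "p powr (r + \<alpha>) * opt_value n \<le> total_cost p n y"
      "total_cost p n y = p powr (r + \<alpha>) * opt_value n \<Longrightarrow> (\<forall>i\<le>n. y i = p * (\<Prod>j=Suc i..n. G j))"
      using Suc.IH[OF sm Suc.prems(2) 3(1) eq_refl[OF p_def]] by blast+
    define l where "l = p / T"
    have l: "0 < l" "l < 1" "p = T * l" using 3 T by (auto simp: l_def)
    have pl: "p powr (r + \<alpha>) * opt_value n = P * (l powr (r + \<alpha>) * opt_value n)"
      using l T by (simp add: P_def powr_mult)
    have m: "max p 0 = p" "min q T = T" using 3 Tq by auto
    have c0: "cell T p T = P * cell 1 l 1" unfolding l(3) P_def by (rule cell_normalize[OF T])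
    have c: "P * cell 1 l 1 \<le> cell T p q" "T < q \<Longrightarrow> P * cell 1 l 1 < cell T p q"
      using cell_shrink[of p q T, unfolded m c0] 3 by auto
    have o: "l \<noteq> G (Suc n) \<Longrightarrow> opt_value (Suc n) < cell 1 l 1 + l powr (r + \<alpha>) * opt_value n"
      using opt_value_less[OF n l(1)] l by simp
    have o': "l = G (Suc n) \<Longrightarrow> opt_value (Suc n) = cell 1 l 1 + l powr (r + \<alpha>) * opt_value n"
      using opt_value_Suc[OF n] by simp
    have sum_eq: "P * cell 1 l 1 + p powr (r + \<alpha>) * opt_value n = P * (cell 1 l 1 + l powr (r + \<alpha>) * opt_value n)"
      unfolding pl by (simp only: distrib_left)
    have Po: "l \<noteq> G (Suc n) \<Longrightarrow> P * opt_value (Suc n) < P * cell 1 l 1 + p powr (r + \<alpha>) * opt_value n"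
      unfolding sum_eq using o P by (rule mult_strict_left_mono)
    have Po': "l = G (Suc n) \<Longrightarrow> P * opt_value (Suc n) = P * cell 1 l 1 + p powr (r + \<alpha>) * opt_value n"
      unfolding sum_eq using o' by simp
    have le: "P * opt_value (Suc n) \<le> total_cost T (Suc n) y"
      using Po Po' c(1) IH(1) unfolding total trunc by (cases "l = G (Suc n)") auto
    have "y i = T * (\<Prod>j=Suc i..Suc n. G j)" if eq: "total_cost T (Suc n) y = P * opt_value (Suc n)" and i: "i \<le> Suc n" for i
    proof -
      have lG: "l = G (Suc n)" using Po c(1) IH(1) eq unfolding total trunc by force
      have q: "q = T" using Po'[OF lG] c(2) IH(1) eq Tq unfolding total trunc by force
      have "\<forall>i\<le>n. y i = p * (\<Prod>j=Suc i..n. G j)"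
        using Po'[OF lG] c(1) IH(1) eq unfolding total trunc by (intro IH(2)) auto
      then show ?thesis using i q l lG by (cases "i = Suc n") (auto simp: q_def)
    qed
    then show ?thesis using le by (auto simp: P_def)
  qed
qed

lemma G_prod_bounds: "1 \<le> i \<Longrightarrow> 0 \<le> (\<Prod>j=i..n. G j)" "1 \<le> i \<Longrightarrow> (\<Prod>j=i..n. G j) \<le> 1"
  using G_bounds by (auto intro!: prod_nonneg prod_le_1 simp: less_imp_le)

lemma G_prod_strict_mono: "strict_mono_on {..n} (\<lambda>i. \<Prod>j=Suc i..n. G j)"
proof -
  have step: "(\<Prod>j=Suc k..n. G j) < (\<Prod>j=Suc (Suc k)..n. G j)" if "Suc k \<le> n" for k
  proof -
    \<comment> \<open>The indices start at 2 at least, which avoids the factor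
      \<open>G 1 = 0\<close>.\<close>
    have "0 < (\<Prod>j=Suc (Suc k)..n. G j)" by (intro prod_pos ballI G_pos) auto
    moreover have "(\<Prod>j=Suc k..n. G j) = G (Suc k) * (\<Prod>j=Suc (Suc k)..n. G j)"
      using that by (rule prod.atLeast_Suc_atMost)
    ultimately show ?thesis using G_bounds[of "Suc k"] by simp
  qed
  have "(\<Prod>j=Suc i..n. G j) < (\<Prod>j=Suc k..n. G j)" if "i < k" "k \<le> n" for i k
    using that
  proof (induction k)
    case (Suc k)
    then show ?case using step[of k] by (cases "i = k") auto
  qed simp
  then show ?thesis by (auto simp: strict_mono_on_def)
qed

text \<open>The configuration is self-similar: without its last point it is the one for n cells,
  scaled to \<open>T * G (Suc n)\<close>.\<close>

lemma total_cost_attained: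
  assumes "1 \<le> n" "0 < T"
  shows "total_cost T n (\<lambda>i. T * (\<Prod>j=Suc i..n. G j)) = T powr (r + \<alpha>) * opt_value n"
  using assms
proof (induction n arbitrary: T rule: dec_induct)
  case base
  then show ?case using cell_normalize[of T 0] opt_value_1 by (simp add: total_cost_def)
next
  case (step n)
  define g where "g = G (Suc n)"
  have g: "0 < g" "g < 1" using G_pos[of "Suc n"] G_bounds[of "Suc n"] step by (auto simp: g_def)
  define y where "y i = T * g * (\<Prod>j=Suc i..n. G j)" for i
  have y: "T * (\<Prod>j=Suc i..Suc n. G j) = y i" if "i \<le> n" for i
    using that by (simp add: y_def g_def)
  have le: "y i \<le> T * g" for i
    unfolding y_def using step.prems g G_prod_bounds(2)[of "Suc i" n] by (intro mult_left_le) auto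
  have "total_cost T n (\<lambda>i. T * (\<Prod>j=Suc i..Suc n. G j)) = total_cost T n y"
    unfolding total_cost_def using y by (intro sum.cong) auto
  also have "\<dots> = total_cost (T * g) n y"
    using le step.prems g by (intro total_cost_truncate) (auto intro: mult_left_le)
  also have "\<dots> = (T * g) powr (r + \<alpha>) * opt_value n"
    unfolding y_def using step.IH[of "T * g"] step.prems g by simp
  finally have "total_cost T (Suc n) (\<lambda>i. T * (\<Prod>j=Suc i..Suc n. G j))
     = (T * g) powr (r + \<alpha>) * opt_value n + cell T (T * g) T"
    unfolding total_cost_Suc by (simp add: g_def)
  also have "\<dots> = T powr (r + \<alpha>) * opt_value (Suc n)"
    using cell_normalize[OF step.prems, of g] opt_value_Suc[OF step.hyps(1)] step.prems g
    by (simp add: g_def powr_mult algebra_simps)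
  finally show ?case .
qed

end

section \<open>Grids for power densities on an interval\<close>

text \<open>Positivity is asked only in the interior: by \<open>0 powr e = 0\<close>, the densities
  at hand vanish at the endpoint from which the power is measured.\<close>

lemma measure_support_interval:
  fixes g :: "real \<Rightarrow> real"
  assumes [measurable]: "g \<in> borel_measurable borel" and "a < b"
    and pos: "\<And>x. a < x \<Longrightarrow> x < b \<Longrightarrow> 0 < g x" and zero: "\<And>x. x \<notin> {a..b} \<Longrightarrow> g x = 0"
  shows "measure_support (density lborel (\<lambda>x. ennreal (g x))) = {a..b}"
proof (intro set_eqI iffI)
  fix x assume x: "x \<in> measure_support (density lborel (\<lambda>x. ennreal (g x)))"
  show "x \<in> {a..b}"
  proof (rule ccontr)
    assume "x \<notin> {a..b}"
    then have "x \<in> - {a..b}" "open (- {a..b})" by auto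
    then have "0 < emeasure (density lborel (\<lambda>x. ennreal (g x))) (- {a..b})"
      using x unfolding measure_support_def by blast
    also have "\<dots> = (\<integral>\<^sup>+x. ennreal (g x) * indicator (- {a..b}) x \<partial>lborel)"
      by (intro emeasure_density) auto
    also have "\<dots> = (\<integral>\<^sup>+x. 0 \<partial>(lborel :: real measure))"
    proof (rule nn_integral_cong)
      fix x show "ennreal (g x) * indicator (- {a..b}) x = 0"
        using zero[of x] by (cases "x \<in> {a..b}") simp_all
    qed
    finally show False by simp
  qed
next
  fix x assume x: "x \<in> {a..b}"
  have "0 < emeasure (density lborel (\<lambda>x. ennreal (g x))) U" if U: "open U" "x \<in> U" for U
  proof (rule ccontr)
    assume "\<not> 0 < emeasure (density lborel (\<lambda>x. ennreal (g x))) U"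
    then have "(\<integral>\<^sup>+x. ennreal (g x) * indicator U x \<partial>lborel) = 0"
      using U(1) by (subst (asm) emeasure_density) auto
    then have "AE x in lborel. ennreal (g x) * indicator U x = 0"
      using U(1) by (subst (asm) nn_integral_0_iff_AE) auto
    then have ae: "AE x in lborel. x \<notin> U \<inter> {a<..<b}"
      by (elim eventually_mono) (use pos in \<open>force simp: indicator_def\<close>)
    have opn: "open (U \<inter> {a<..<b})" using U by auto
    have "U \<inter> {a<..<b} \<noteq> {}"
    proof -
      have "x \<in> closure {a<..<b}" using x \<open>a < b\<close> by (simp add: closure_greaterThanLessThan)
      then show ?thesis using U by (metis Int_commute disjoint_iff open_Int_closure_eq_empty)
    qed
    then obtain z where "z \<in> U \<inter> {a<..<b}" by blast
    then obtain e where e: "0 < e" "ball z e \<subseteq> U \<inter> {a<..<b}"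
      using opn by (meson open_contains_ball)
    have "{z<..<z + e} \<subseteq> ball z e" by (auto simp: dist_real_def)
    then have "emeasure lborel {z<..<z + e} \<le> emeasure lborel (U \<inter> {a<..<b})"
      using e opn by (intro emeasure_mono) auto
    moreover have "emeasure lborel {z<..<z + e} = ennreal e"
      using emeasure_lborel_Ioo[of z "z + e"] e by simp
    moreover have "emeasure lborel (U \<inter> {a<..<b}) = 0"
      by (rule AE_iff_measurable[THEN iffD1, OF _ _ ae]) (use opn in auto)
    ultimately show False using e by simp
  qed
  then show "x \<in> measure_support (density lborel (\<lambda>x. ennreal (g x)))"
    by (auto simp: measure_support_def)
qed

lemma sorted_list_of_set_strict_mono_image:
  fixes x :: "nat \<Rightarrow> 'a::linorder"
  assumes "strict_mono_on {..n} x"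
  shows "sorted_list_of_set (x ` {..n}) = map x [0..<Suc n]" "card (x ` {..n}) = Suc n"
proof -
  have inj: "inj_on x {..n}" using assms by (rule strict_mono_on_imp_inj_on)
  then show c: "card (x ` {..n}) = Suc n" by (simp add: card_image)
  have "sorted_wrt (<) (map x [0..<Suc n])"
    using assms by (auto simp: sorted_wrt_iff_nth_less strict_mono_on_def simp del: upt_Suc)
  moreover have "set (map x [0..<Suc n]) = x ` {..n}" by (auto simp del: upt_Suc)
  moreover have "length (map x [0..<Suc n]) = card (x ` {..n})" using c by simp
  ultimately show "sorted_list_of_set (x ` {..n}) = map x [0..<Suc n]"
    using sorted_list_of_set_unique[of "x ` {..n}" "map x [0..<Suc n]"] by blast
qed

lemma image_diff_atMost_self: "(\<lambda>i. n - i) ` {..n} = {..n::nat}"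
proof (intro equalityI subsetI)
  fix k assume "k \<in> {..n}"
  then show "k \<in> (\<lambda>i. n - i) ` {..n}" by (intro image_eqI[of _ _ "n - k"]) auto
qed auto

section \<open>Both densities as affine images of one problem\<close>

text \<open>The coordinate z in \<open>t + c * z\<close> is the normalised distance from the
  endpoint t from which the power is measured; the slope c is negative for the reflected density. In
  z both densities have the same form.\<close>

locale affine_power_law = dual_quant +
  fixes a b c t :: real and g :: "real \<Rightarrow> real"
  assumes ab: "a < b" and orient: "(c = b - a \<and> t = a) \<or> (c = a - b \<and> t = b)"
    and g_measurable [measurable]: "g \<in> borel_measurable borel"
    and g_eq: "\<And>z. g (t + c * z) = indicator {0..1} z * (\<alpha> * z powr (\<alpha> - 1) / (b - a))"
begin

definition \<mu> :: "real measure" where "\<mu> = density lborel (\<lambda>x. ennreal (g x))"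

text \<open>The factor \<alpha> comes from the density and \<open>(b - a) powr r\<close> from the
  homogeneity of the local cost; the length from the change of variables cancels against the
  denominator in \<open>g_eq\<close>.\<close>

definition K :: real where "K = \<alpha> * (b - a) powr r"

lemma c_nz: "c \<noteq> 0" using ab orient by auto

lemma affine_surj: obtains z where "x = t + c * z"
  using c_nz that[of "(x - t) / c"] by simp

lemma affine_range:
  "a < t + c * z \<and> t + c * z < b \<longleftrightarrow> 0 < z \<and> z < 1"
  "a \<le> t + c * z \<and> t + c * z \<le> b \<longleftrightarrow> 0 \<le> z \<and> z \<le> 1"
proof -
  define P where "P = (b - a) * z"
  have P: "0 < P \<longleftrightarrow> 0 < z" "0 \<le> P \<longleftrightarrow> 0 \<le> z" "P < b - a \<longleftrightarrow> z < 1" "P \<le> b - a \<longleftrightarrow> z \<le> 1"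
    unfolding P_def using ab by (simp_all add: zero_less_mult_iff zero_le_mult_iff)
  have "t + c * z = a + P \<or> t + c * z = b - P"
    using orient by (auto simp: P_def algebra_simps)
  then show "a < t + c * z \<and> t + c * z < b \<longleftrightarrow> 0 < z \<and> z < 1"
    "a \<le> t + c * z \<and> t + c * z \<le> b \<longleftrightarrow> 0 \<le> z \<and> z \<le> 1"
    unfolding P[symmetric] by auto
qed

lemma g_nonneg: "0 \<le> g x"
  using ab alpha_pos by (rule_tac affine_surj[of x]) (auto simp: g_eq indicator_def)

text \<open>Minimum and maximum allow for the exchange of the cell ends when c is negative; the
  symmetry of \<open>interp\<close> makes the reflection harmless.\<close>

lemma cost_term:
  assumes "p < q" and uv: "u = min (t + c * p) (t + c * q)" "v = max (t + c * p) (t + c * q)"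
  shows "set_lebesgue_integral \<mu> {u..<v} (\<lambda>\<xi>. (\<xi> - u) powr r * ((v - \<xi>) / (v - u)) + (v - \<xi>) powr r * ((\<xi> - u) / (v - u)))
    = K * cell 1 p q"
proof -
  define f where "f \<xi> = (\<xi> - u) powr r * ((v - \<xi>) / (v - u)) + (v - \<xi>) powr r * ((\<xi> - u) / (v - u))" for \<xi>
  define L where "L = b - a"
  have L: "0 < L" using ab by (simp add: L_def)
  have cL: "\<bar>c\<bar> = L" using orient ab by (auto simp: L_def)
  have [measurable]: "f \<in> borel_measurable borel" unfolding f_def by measurable
  have f_interp: "f (t + c * z) = L powr r * interp r (z - p) (q - z)" if z: "p < z" "z < q" for z
  proof -
    have "f \<xi> = interp r (\<xi> - u) (v - \<xi>)" for \<xi>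
      by (simp add: f_def interp_def add_divide_distrib)
    moreover have "interp r (t + c * z - u) (v - (t + c * z)) = interp r (L * (z - p)) (L * (q - z))"
      using orient
    proof
      assume h: "c = b - a \<and> t = a"
      then have "L * p < L * q" using L assms(1) by simp
      then have "u = t + L * p" "v = t + L * q" "c = L" using h uv by (auto simp: L_def)
      then show ?thesis by (simp add: algebra_simps)
    next
      assume h: "c = a - b \<and> t = b"
      then have "L * p < L * q" "c = - L" using L assms(1) by (auto simp: L_def)
      then have "u = t - L * q" "v = t - L * p" "c = - L" using uv by auto
      then have "t + c * z - u = L * (q - z)" "v - (t + c * z) = L * (z - p)" by (simp_all add: algebra_simps)
      then show ?thesis by (simp only: interp_commute[of r "L * (q - z)"])
    qed
    ultimately show ?thesis using interp_scale[OF L, of "z - p" "q - z"] z by simp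
  qed
  \<comment> \<open>Half-open and open cells differ only at end points, a null set discarded below
    by \<open>integral_cong_AE\<close>.\<close>
  have ind: "indicator {u..<v} (t + c * z) = (indicator {p<..<q} z :: real)" if "z \<noteq> p" "z \<noteq> q" for z
    using orient
  proof
    assume h: "c = b - a \<and> t = a"
    then have "L * p < L * q" using L assms(1) by simp
    then have "u = t + L * p" "v = t + L * q" "c = L" using h uv by (auto simp: L_def)
    then show ?thesis using L that by (auto simp: indicator_def)
  next
    assume h: "c = a - b \<and> t = b"
    then have "L * p < L * q" "c = - L" using L assms(1) by (auto simp: L_def)
    then have "u = t - L * q" "v = t - L * p" "c = - L" using uv by auto
    then show ?thesis using L that by (auto simp: indicator_def)
  qed
  have "set_lebesgue_integral \<mu> {u..<v} f = (\<integral>x. g x *\<^sub>R (indicator {u..<v} x *\<^sub>R f x) \<partial>lborel)"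
    unfolding set_lebesgue_integral_def \<mu>_def by (intro integral_density) (auto simp: g_nonneg)
  also have "\<dots> = \<bar>c\<bar> *\<^sub>R (\<integral>z. g (t + c * z) *\<^sub>R (indicator {u..<v} (t + c * z) *\<^sub>R f (t + c * z)) \<partial>lborel)"
    by (rule lborel_integral_real_affine[OF c_nz])
  also have "(\<integral>z. g (t + c * z) *\<^sub>R (indicator {u..<v} (t + c * z) *\<^sub>R f (t + c * z)) \<partial>lborel)
     = (\<integral>z. (\<alpha> * L powr r / L) * cell_density 1 p q z \<partial>lborel)"
  proof (rule integral_cong_AE)
    show "AE z in lborel. g (t + c * z) *\<^sub>R (indicator {u..<v} (t + c * z) *\<^sub>R f (t + c * z)) = (\<alpha> * L powr r / L) * cell_density 1 p q z"
      using AE_lborel_singleton[of p] AE_lborel_singleton[of q] AE_lborel_singleton[of 0] AE_lborel_singleton[of 1]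
    proof eventually_elim
      case (elim z)
      show ?case unfolding ind[OF elim(1,2)] g_eq using elim(3,4)
        by (cases "p < z \<and> z < q") (auto simp: f_interp cell_density_def indicator_def L_def)
    qed
  qed auto
  also have "\<bar>c\<bar> *\<^sub>R \<dots> = K * cell 1 p q"
    using L unfolding cL by (simp add: K_def cell_def L_def[symmetric])
  finally show ?thesis unfolding f_def .
qed

lemma cost_image:
  assumes y: "strict_mono_on {..n} y"
  shows "dual_quant_cost \<mu> r ((\<lambda>i. t + c * y i) ` {..n}) = K * total_cost 1 n y"
    and "card ((\<lambda>i. t + c * y i) ` {..n}) = Suc n"
proof -
  have yl: "y i < y (Suc i)" if "i < n" for i
    by (rule strict_mono_onD[OF y]) (use that in auto)
  have aux: "dual_quant_cost \<mu> r (x ` {..n}) = (\<Sum>i<n. K * cell 1 (p i) (q i)) \<and> card (x ` {..n}) = Suc n"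
    if x: "strict_mono_on {..n} x"
      and pq: "\<And>i. i < n \<Longrightarrow> p i < q i \<and> x i = min (t + c * p i) (t + c * q i) \<and> x (Suc i) = max (t + c * p i) (t + c * q i)"
    for x p q
  proof -
    have nth: "map x [0..<Suc n] ! i = x i" if "i \<le> n" for i
      using that by (simp del: upt_Suc)
    show ?thesis
      unfolding dual_quant_cost_def Let_def sorted_list_of_set_strict_mono_image[OF x]
      using pq by (auto intro!: sum.cong simp: nth cost_term[symmetric] simp del: upt_Suc)
  qed
  have "dual_quant_cost \<mu> r ((\<lambda>i. t + c * y i) ` {..n}) = K * total_cost 1 n y \<and> card ((\<lambda>i. t + c * y i) ` {..n}) = Suc n"
    using orient
  proof
    assume h: "c = b - a \<and> t = a"
    have "strict_mono_on {..n} (\<lambda>i. t + c * y i)"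
      using y h ab by (auto simp: strict_mono_on_def)
    from aux[OF this, of y "\<lambda>i. y (Suc i)"] show ?thesis
      using h ab yl by (simp add: less_imp_le total_cost_def sum_distrib_left)
  next
    assume h: "c = a - b \<and> t = b"
    \<comment> \<open>For negative c the increasing enumeration of the grid runs through y
      backwards.\<close>
    have im: "(\<lambda>i. t + c * y i) ` {..n} = (\<lambda>i. t + c * y (n - i)) ` {..n}"
    proof -
      have "(\<lambda>i. t + c * y i) ` (\<lambda>i. n - i) ` {..n} = (\<lambda>i. t + c * y (n - i)) ` {..n}" by (rule image_image)
      then show ?thesis by (simp only: image_diff_atMost_self)
    qed
    have sm: "strict_mono_on {..n} (\<lambda>i. t + c * y (n - i))"
      using h ab strict_mono_onD[OF y] by (auto simp: strict_mono_on_def intro!: mult_strict_left_mono_neg)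
    have pq: "y (n - Suc i) < y (n - i) \<and> t + c * y (n - i) = min (t + c * y (n - Suc i)) (t + c * y (n - i))
        \<and> t + c * y (n - Suc i) = max (t + c * y (n - Suc i)) (t + c * y (n - i))" if "i < n" for i
    proof -
      have "y (n - Suc i) < y (n - i)" using yl[of "n - Suc i"] that by (simp add: Suc_diff_Suc)
      moreover from this have "c * y (n - i) < c * y (n - Suc i)"
        using h ab by (intro mult_strict_left_mono_neg) auto
      ultimately show ?thesis by simp
    qed
    have "(\<Sum>i<n. K * cell 1 (y (n - Suc i)) (y (n - i))) = (\<Sum>i<n. (\<lambda>k. K * cell 1 (y k) (y (Suc k))) (n - Suc i))"
      by (intro sum.cong) (auto simp: Suc_diff_Suc)
    also have "\<dots> = K * total_cost 1 n y"
      by (subst sum.nat_diff_reindex) (simp add: total_cost_def sum_distrib_left)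
    finally show ?thesis
      using aux[OF sm, of "\<lambda>i. y (n - Suc i)" "\<lambda>i. y (n - i)", OF pq] unfolding im by simp
  qed
  then show "dual_quant_cost \<mu> r ((\<lambda>i. t + c * y i) ` {..n}) = K * total_cost 1 n y"
    "card ((\<lambda>i. t + c * y i) ` {..n}) = Suc n" by auto
qed

lemma finite_set_as_image:
  assumes "finite \<Gamma>" "\<Gamma> \<noteq> {}"
  obtains n :: nat and y where "strict_mono_on {..n} y" "\<Gamma> = (\<lambda>i. t + c * y i) ` {..n}"
proof -
  define xs where "xs = sorted_list_of_set \<Gamma>"
  define n where "n = card \<Gamma> - 1"
  have len: "length xs = Suc n" using assms by (simp add: xs_def n_def card_gt_0_iff)
  have set: "\<Gamma> = (\<lambda>i. xs ! i) ` {..n}"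
  proof -
    have "\<Gamma> = set xs" using assms by (simp add: xs_def)
    also have "\<dots> = (\<lambda>i. xs ! i) ` {..<length xs}" by (auto simp: set_conv_nth)
    finally show ?thesis by (simp add: len lessThan_Suc_atMost)
  qed
  have lt: "xs ! i < xs ! j" if "i < j" "j \<le> n" for i j
    using that len strict_sorted_list_of_set[of \<Gamma>] by (auto simp: xs_def sorted_wrt_iff_nth_less)
  show ?thesis using orient
  proof
    assume h: "c = b - a \<and> t = a"
    show ?thesis
    proof (rule that[of n "\<lambda>i. (xs ! i - t) / c"])
      show "strict_mono_on {..n} (\<lambda>i. (xs ! i - t) / c)"
        using lt h ab by (auto simp: strict_mono_on_def intro!: divide_strict_right_mono)
      show "\<Gamma> = (\<lambda>i. t + c * ((xs ! i - t) / c)) ` {..n}" using set c_nz by simp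
    qed
  next
    assume h: "c = a - b \<and> t = b"
    show ?thesis
    proof (rule that[of n "\<lambda>i. (xs ! (n - i) - t) / c"])
      show "strict_mono_on {..n} (\<lambda>i. (xs ! (n - i) - t) / c)"
        using lt h ab by (auto simp: strict_mono_on_def intro!: divide_strict_right_mono_neg)
      have "(\<lambda>i. xs ! i) ` (\<lambda>i. n - i) ` {..n} = (\<lambda>i. xs ! (n - i)) ` {..n}" by (rule image_image)
      then have "\<Gamma> = (\<lambda>i. xs ! (n - i)) ` {..n}" using set by (simp only: image_diff_atMost_self)
      then show "\<Gamma> = (\<lambda>i. t + c * ((xs ! (n - i) - t) / c)) ` {..n}" using c_nz by simp
    qed
  qed
qed

lemma grid_iff:
  "dual_quant_grid \<mu> N \<Gamma> \<longleftrightarrow> finite \<Gamma> \<and> \<Gamma> \<noteq> {} \<and> card \<Gamma> \<le> N \<and> Min \<Gamma> \<le> a \<and> b \<le> Max \<Gamma>"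
proof -
  have "measure_support \<mu> = {a..b}" unfolding \<mu>_def
  proof (rule measure_support_interval[OF g_measurable ab])
    fix x
    obtain z where z: "x = t + c * z" by (rule affine_surj)
    show "a < x \<Longrightarrow> x < b \<Longrightarrow> 0 < g x"
      using affine_range(1)[of z] ab alpha_pos unfolding z g_eq by (simp add: indicator_def)
    show "x \<notin> {a..b} \<Longrightarrow> g x = 0"
      using affine_range(2)[of z] unfolding z g_eq by (simp add: indicator_def)
  qed
  then have "convex hull (measure_support \<mu>) = {a..b}" by (simp add: hull_same)
  then show ?thesis using ab by (auto simp: dual_quant_grid_def)
qed

text \<open>N points bound N - 1 cells, and points are counted from 0 here, hence products from
  \<open>Suc i\<close>. A competitor with n cells costs at least \<open>K * opt_value n\<close>; for
  fewer than N - 1 cells this is strictly too much, and otherwise equality determines every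
  point.\<close>

lemma optimal_grids:
  assumes N: "2 \<le> N"
  shows "{\<Gamma>. optimal_dual_quant_grid \<mu> r N \<Gamma>} = {(\<lambda>i. t + c * (\<Prod>j=Suc i..N - 1. G j)) ` {..N - 1}}"
proof -
  define w where "w i = (\<Prod>j=Suc i..N - 1. G j)" for i
  define \<Gamma>0 where "\<Gamma>0 = (\<lambda>i. t + c * w i) ` {..N - 1}"
  have K: "0 < K" using alpha_pos ab by (simp add: K_def)
  have w: "strict_mono_on {..N - 1} w" unfolding w_def by (rule G_prod_strict_mono)
  have cost0: "dual_quant_cost \<mu> r \<Gamma>0 = K * opt_value (N - 1)"
    unfolding \<Gamma>0_def cost_image(1)[OF w] using total_cost_attained[of "N - 1" 1] N by (simp add: w_def[abs_def])
  \<comment> \<open>The product contains \<open>G 1 = 0\<close>, as N \<ge> 2. So the two extreme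
    points are the endpoints of the interval.\<close>
  have "w 0 = 0" using N by (auto simp: w_def intro!: prod_zero bexI[of _ 1])
  moreover have "w (N - 1) = 1" by (simp add: w_def)
  ultimately have "t \<in> \<Gamma>0" "t + c \<in> \<Gamma>0" unfolding \<Gamma>0_def by (force intro: image_eqI)+
  then have ab0: "a \<in> \<Gamma>0" "b \<in> \<Gamma>0" using orient by auto
  have grid0: "dual_quant_grid \<mu> N \<Gamma>0"
    unfolding grid_iff
  proof (intro conjI)
    show "finite \<Gamma>0" by (simp add: \<Gamma>0_def)
    then show "Min \<Gamma>0 \<le> a" "b \<le> Max \<Gamma>0" using ab0 by auto
    show "\<Gamma>0 \<noteq> {}" using ab0 by auto
    show "card \<Gamma>0 \<le> N" unfolding \<Gamma>0_def cost_image(2)[OF w] using N by simp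
  qed
  have low: "K * opt_value (N - 1) \<le> dual_quant_cost \<mu> r \<Gamma> \<and>
      (dual_quant_cost \<mu> r \<Gamma> = K * opt_value (N - 1) \<longrightarrow> \<Gamma> = \<Gamma>0)" if gr: "dual_quant_grid \<mu> N \<Gamma>" for \<Gamma>
  proof -
    have fin: "finite \<Gamma>" "\<Gamma> \<noteq> {}" and card: "card \<Gamma> \<le> N" and mm: "Min \<Gamma> \<le> a" "b \<le> Max \<Gamma>"
      using gr by (auto simp: grid_iff)
    obtain n :: nat and y where y: "strict_mono_on {..n} y" and \<Gamma>: "\<Gamma> = (\<lambda>i. t + c * y i) ` {..n}"
      by (rule finite_set_as_image[OF fin])
    have "Min \<Gamma> \<in> \<Gamma>" "Max \<Gamma> \<in> \<Gamma>" using fin by auto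
    then obtain i k where ik: "i \<le> n" "k \<le> n" "t + c * y i \<le> a" "b \<le> t + c * y k"
      using mm unfolding \<Gamma> by (metis (no_types, lifting) atMost_iff imageE)
    have mono: "y 0 \<le> y i" "y i \<le> y n" "y 0 \<le> y k" "y k \<le> y n"
      using ik by (auto intro!: strict_mono_on_leD[OF y])
    \<comment> \<open>With a negative slope it is the largest grid point that gives
      \<open>y 0 \<le> 0\<close> and the smallest one that gives \<open>1 \<le> y n\<close>.\<close>
    have y01: "y 0 \<le> 0 \<and> 1 \<le> y n"
      using orient
    proof
      assume h: "c = b - a \<and> t = a"
      then have "(b - a) * y i \<le> (b - a) * 0" "(b - a) * 1 \<le> (b - a) * y k" using ik by auto
      then have "y i \<le> 0" "1 \<le> y k" using ab by (simp_all only: mult_le_cancel_left_pos diff_gt_0_iff_gt)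
      then show ?thesis using mono by auto
    next
      assume h: "c = a - b \<and> t = b"
      then have "(b - a) * y k \<le> (b - a) * 0" "(b - a) * 1 \<le> (b - a) * y i" using ik by (auto simp: algebra_simps)
      then have "y k \<le> 0" "1 \<le> y i" using ab by (simp_all only: mult_le_cancel_left_pos diff_gt_0_iff_gt)
      then show ?thesis using mono by auto
    qed
    have n: "1 \<le> n" using y01 by (cases n) auto
    have nN: "n \<le> N - 1" using card cost_image(2)[OF y] unfolding \<Gamma> by simp
    have lb: "opt_value n \<le> total_cost 1 n y" "total_cost 1 n y = opt_value n \<Longrightarrow> \<forall>i\<le>n. y i = (\<Prod>j=Suc i..n. G j)"
      using total_cost_lower_bound[OF y, of 1] y01 by auto
    have cost: "dual_quant_cost \<mu> r \<Gamma> = K * total_cost 1 n y" unfolding \<Gamma> by (rule cost_image(1)[OF y])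
    show ?thesis
    proof (cases "n = N - 1")
      case True
      have "\<Gamma> = \<Gamma>0" if "dual_quant_cost \<mu> r \<Gamma> = K * opt_value (N - 1)"
      proof -
        have "total_cost 1 n y = opt_value n" using that cost K True by simp
        from lb(2)[OF this] show ?thesis
          unfolding \<Gamma> \<Gamma>0_def True by (intro image_cong) (auto simp: w_def)
      qed
      then show ?thesis using lb(1) K cost True by simp
    next
      case False
      then have "opt_value (N - 1) < opt_value n" using nN n by (intro opt_value_antimono) auto
      then have "K * opt_value (N - 1) < K * total_cost 1 n y" using lb(1) K by simp
      then show ?thesis unfolding cost by (intro conjI impI) linarith+
    qed
  qed
  show ?thesis unfolding w_def[symmetric] \<Gamma>0_def[symmetric]
  proof (intro set_eqI iffI)
    fix \<Gamma> assume "\<Gamma> \<in> {\<Gamma>. optimal_dual_quant_grid \<mu> r N \<Gamma>}"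
    then have "dual_quant_grid \<mu> N \<Gamma>" "dual_quant_cost \<mu> r \<Gamma> \<le> dual_quant_cost \<mu> r \<Gamma>0"
      using grid0 by (auto simp: optimal_dual_quant_grid_def)
    then show "\<Gamma> \<in> {\<Gamma>0}" using low[of \<Gamma>] cost0 by auto
  next
    fix \<Gamma> assume "\<Gamma> \<in> {\<Gamma>0}"
    then have \<Gamma>: "\<Gamma> = \<Gamma>0" by simp
    show "\<Gamma> \<in> {\<Gamma>. optimal_dual_quant_grid \<mu> r N \<Gamma>}"
      unfolding optimal_dual_quant_grid_def mem_Collect_eq \<Gamma> cost0
      using grid0 low by blast
  qed
qed

end

theorem mainTheorem5:
  fixes r \<alpha> a b :: real
  assumes "r \<ge> 1" and "\<alpha> > 0" and "a < b"
  shows "(\<forall>i\<ge>2. \<exists>!y. y \<in> {0<..<1} \<and>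
            chi r \<alpha> (inverse y - 1) = chi r \<alpha> (grid_ratio r \<alpha> (i - 1) - 1)) \<and>
    (\<forall>N\<ge>3.
      (\<forall>\<mu>. \<mu> = density lborel
              (\<lambda>x. ennreal (indicator {a..b} x * (\<alpha> * (x - a) powr (\<alpha> - 1) / (b - a) powr \<alpha>))) \<longrightarrow>
        (\<exists>x. strict_mono_on {1..N} x \<and>
             (\<forall>i\<in>{1..N}. x i = a + (b - a) * (\<Prod>j=i..N-1. grid_ratio r \<alpha> j)) \<and>
             {\<Gamma>. optimal_dual_quant_grid \<mu> r N \<Gamma>} = {x ` {1..N}})) \<and>
      (\<forall>\<mu>. \<mu> = density lborel
              (\<lambda>x. ennreal (indicator {a..b} x * (\<alpha> * (b - x) powr (\<alpha> - 1) / (b - a) powr \<alpha>))) \<longrightarrow>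
        (\<exists>x. strict_mono_on {1..N} x \<and>
             (\<forall>i\<in>{1..N}. x (N + 1 - i) = b - (b - a) * (\<Prod>j=i..N-1. grid_ratio r \<alpha> j)) \<and>
             {\<Gamma>. optimal_dual_quant_grid \<mu> r N \<Gamma>} = {x ` {1..N}})))"
proof -
  interpret dual_quant r \<alpha> using assms by unfold_locales
  have dens: "\<alpha> * ((b - a) * z) powr (\<alpha> - 1) / (b - a) powr \<alpha> = \<alpha> * z powr (\<alpha> - 1) / (b - a)" if "0 \<le> z" for z
    using assms that by (simp add: powr_mult powr_diff)
  have ind: "indicator {a..b} (a + (b - a) * z) = (indicator {0..1} z :: real)"
    "indicator {a..b} (b + (a - b) * z) = (indicator {0..1} z :: real)" for z
  proof -
    define P where "P = (b - a) * z"
    have "0 \<le> P \<longleftrightarrow> 0 \<le> z" "P \<le> b - a \<longleftrightarrow> z \<le> 1"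
      unfolding P_def using assms by (simp_all add: zero_le_mult_iff)
    moreover have "b + (a - b) * z = b - P" by (simp add: P_def algebra_simps)
    ultimately show "indicator {a..b} (a + (b - a) * z) = (indicator {0..1} z :: real)"
      "indicator {a..b} (b + (a - b) * z) = (indicator {0..1} z :: real)"
      by (auto simp: P_def[symmetric] indicator_def)
  qed
  interpret left: affine_power_law r \<alpha> a b "b - a" a
    "\<lambda>x. indicator {a..b} x * (\<alpha> * (x - a) powr (\<alpha> - 1) / (b - a) powr \<alpha>)"
  proof unfold_locales
    fix z
    show "indicator {a..b} (a + (b - a) * z) * (\<alpha> * (a + (b - a) * z - a) powr (\<alpha> - 1) / (b - a) powr \<alpha>) =
         indicator {0..1} z * (\<alpha> * z powr (\<alpha> - 1) / (b - a))"
      unfolding ind using dens[of z] by (auto simp: indicator_def)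
  qed (use assms in auto)
  interpret right: affine_power_law r \<alpha> a b "a - b" b
    "\<lambda>x. indicator {a..b} x * (\<alpha> * (b - x) powr (\<alpha> - 1) / (b - a) powr \<alpha>)"
  proof unfold_locales
    fix z
    have "b - (b + (a - b) * z) = (b - a) * z" by (simp add: algebra_simps)
    then show "indicator {a..b} (b + (a - b) * z) * (\<alpha> * (b - (b + (a - b) * z)) powr (\<alpha> - 1) / (b - a) powr \<alpha>) =
         indicator {0..1} z * (\<alpha> * z powr (\<alpha> - 1) / (b - a))"
      unfolding ind using dens[of z] by (auto simp: indicator_def)
  qed (use assms in auto)
  show ?thesis
  proof (intro conjI allI impI)
    fix N :: nat and \<nu> :: "real measure"
    assume N: "3 \<le> N" and \<nu>: "\<nu> = density lborel
              (\<lambda>x. ennreal (indicator {a..b} x * (\<alpha> * (x - a) powr (\<alpha> - 1) / (b - a) powr \<alpha>)))"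
    define x where "x i = a + (b - a) * (\<Prod>j=i..N-1. G j)" for i
    have "strict_mono_on {1..N} x"
    proof (rule strict_mono_onI)
      fix i k assume "i \<in> {1..N}" "k \<in> {1..N}" "i < k"
      then show "x i < x k"
        using strict_mono_onD[OF G_prod_strict_mono[of "N - 1"], of "i - 1" "k - 1"] assms(3)
        by (auto simp: x_def)
    qed
    moreover have "x ` {1..N} = (\<lambda>i. a + (b - a) * (\<Prod>j=Suc i..N - 1. G j)) ` {..N - 1}"
    proof -
      have "{1..N} = Suc ` {..N - 1}" using N by (simp add: image_Suc_atMost)
      then show ?thesis by (simp only: image_image x_def)
    qed
    ultimately show "\<exists>x. strict_mono_on {1..N} x \<and>
             (\<forall>i\<in>{1..N}. x i = a + (b - a) * (\<Prod>j=i..N-1. G j)) \<and>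
             {\<Gamma>. optimal_dual_quant_grid \<nu> r N \<Gamma>} = {x ` {1..N}}"
      using left.optimal_grids[of N] N unfolding \<nu> left.\<mu>_def by (intro exI[of _ x]) (simp add: x_def)
  next
    fix N :: nat and \<nu> :: "real measure"
    assume N: "3 \<le> N" and \<nu>: "\<nu> = density lborel
              (\<lambda>x. ennreal (indicator {a..b} x * (\<alpha> * (b - x) powr (\<alpha> - 1) / (b - a) powr \<alpha>)))"
    \<comment> \<open>The stated formula with i replaced by N + 1 - i, so that the points are
      enumerated in increasing order.\<close>
    define x where "x i = b - (b - a) * (\<Prod>j=N+1-i..N-1. G j)" for i
    have "strict_mono_on {1..N} x"
    proof (rule strict_mono_onI)
      fix i k assume "i \<in> {1..N}" "k \<in> {1..N}" "i < k"
      then show "x i < x k"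
        using strict_mono_onD[OF G_prod_strict_mono[of "N - 1"], of "N - k" "N - i"] assms(3)
        by (auto simp: x_def Suc_diff_le)
    qed
    moreover have "x ` {1..N} = (\<lambda>i. b + (a - b) * (\<Prod>j=Suc i..N - 1. G j)) ` {..N - 1}"
    proof -
      have "{1..N} = (\<lambda>i. N - i) ` {..N - 1}"
      proof (intro equalityI subsetI)
        fix k assume "k \<in> {1..N}"
        then show "k \<in> (\<lambda>i. N - i) ` {..N - 1}" by (intro image_eqI[of _ _ "N - k"]) auto
      qed (use N in auto)
      moreover have "x (N - i) = b + (a - b) * (\<Prod>j=Suc i..N - 1. G j)" if "i \<in> {..N - 1}" for i
        using that N by (simp add: x_def Suc_diff_le algebra_simps)
      ultimately show ?thesis by (simp only: image_image cong: image_cong)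
    qed
    ultimately show "\<exists>x. strict_mono_on {1..N} x \<and>
             (\<forall>i\<in>{1..N}. x (N + 1 - i) = b - (b - a) * (\<Prod>j=i..N-1. G j)) \<and>
             {\<Gamma>. optimal_dual_quant_grid \<nu> r N \<Gamma>} = {x ` {1..N}}"
      using right.optimal_grids[of N] N unfolding \<nu> right.\<mu>_def by (intro exI[of _ x]) (simp add: x_def)
  qed (use ratio_well_defined in blast)
qed

end
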